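(* Let $\alpha>0$, $Z=L^2([0,1])$, and let $\mathcal{S}(t)$ be the strongly continuous semigroup on $Z$ generated by $\mathcal{A}z=\alpha\,\partial_x^2z$ with domain $D(\mathcal{A})=H^2(0,1)\cap H^1_0(0,1)$. For $n\in\mathbb{N}$ ($n\ge1$) set $\Delta_n=\tfrac1{n+1}$, $x_{n,k}=k\Delta_n$, and let $Z_n=\mathbb{R}^n$ with the norm $\|z_n\|_{Z_n}^2=\Delta_n\sum_{k=1}^n|(z_n)_k|^2$ and the corresponding inner product. Define $\mathcal{P}_n\colon Z\to Z_n$ and $\mathcal{E}_n\colon Z_n\to Z$ by $$(\mathcal{P}_nz)_k=\frac1{\Delta_n}\int_{x_{n,k}-\Delta_n/2}^{x_{n,k}+\Delta_n/2}z(s)\,\mathrm{d}s\quad(1\le k\le n),\qquad \mathcal{E}_nz_n=\sum_{k=1}^n(z_n)_k\,\chi_{[x_{n,k}-\Delta_n/2,\;x_{n,k}+\Delta_n/2)},$$ where $\chi_I$ is the indicator function of $I$. Let $\mathcal{A}_n\in\mathbb{R}^{n\times n}$ be the tridiagonal matrix with diagonal entries $-2\alpha/\Delta_n^2$ and sub- and superdiagonal entries $\alpha/\Delta_n^2$, and let $\mathcal{S}_n(t)=e^{\mathcal{A}_nt}$. Set $M_n=1$ and $$\omega_n=-\alpha\Big(2(n+1)\sin\big(\tfrac{\pi}{2(n+1)}\big)\Big)^2.$$ Then 1. the sequence $(Z_n,\mathcal{P}_n,\mathcal{E}_n)_{n\in\mathbb{N}}$ is an approximation sequence for $Z$ with $\mu_{\mathrm{p}}=\mu_{\mathrm{e}}=1$;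 2. $(\mathcal{S}_n(t))_{n\in\mathbb{N}}$ converges to $\mathcal{S}(t)$; 3. $\lim_{n\to\infty}M_n=1$, $\omega^\star:=\lim_{n\to\infty}\omega_n=-\alpha\pi^2$, and $\omega^\star\le\omega_n$ for all $n\in\mathbb{N}$.
   Context: $\mathcal{L}(X,Y)$ denotes the bounded linear operators from $X$ to $Y$. Approximation sequence: a sequence of triples $(Z_n,\mathcal{P}_n,\mathcal{E}_n)_{n\in\mathbb{N}}$, each consisting of a Banach space $(Z_n,\|\cdot\|_{Z_n})$, a bounded linear operator $\mathcal{P}_n\colon Z\to Z_n$ and a (bounded linear) right-inverse $\mathcal{E}_n\colon Z_n\to Z$ of $\mathcal{P}_n$ (so $\mathcal{P}_n\mathcal{E}_n=\mathrm{id}_{Z_n}$), is an approximation sequence for $Z$ if (1) $\lim_{n\to\infty}\|\mathcal{P}_nz\|_{Z_n}=\|z\|_Z$ for every $z\in Z$, and (2) there exist constants $\mu_{\mathrm{p}},\mu_{\mathrm{e}}>0$ with $\|\mathcal{P}_n\|_{\mathcal{L}(Z,Z_n)}\le\mu_{\mathrm{p}}$ and $\|\mathcal{E}_n\|_{\mathcal{L}(Z_n,Z)}\le\mu_{\mathrm{e}}$ for all $n\in\mathbb{N}$. Convergence of vectors: $z_n\in Z_n$ converges to $z\in Z$, written $\lim_{n\to\infty}z_n=z$, if $\|\mathcal{P}_nz-z_n\|_{Z_n}\to0$ as $n\to\infty$. Convergence of semigroups: $(\mathcal{S}_n(t))_{n\in\mathbb{N}}$ converges to $\mathcal{S}(t)$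 if $\lim_{n\to\infty}\mathcal{E}_n\mathcal{S}_n(t)z_n=\mathcal{S}(t)z$ in $Z$ for all $t\ge0$ and all $z_n\in Z_n$, $z\in Z$ with $\lim_{n\to\infty}z_n=z$ in the sense that $\|\mathcal{P}_nz-z_n\|_{Z_n}\to0$ as $n\to\infty$. The number $\omega_n$ is the largest eigenvalue of $\mathcal{A}_n$. *)

theory Defs
  imports "HOL-Analysis.Analysis" "Jordan_Normal_Form.VS_Connect"
begin

hide_const (open) Finite_Cartesian_Product.vec Finite_Cartesian_Product.mat
hide_type (open) Finite_Cartesian_Product.vec
unbundle no vec_syntax

section \<open>The Hilbert space \<open>L\<^sup>2([0,1])\<close>\<close>

text \<open>Representatives are total functions; their values outside \<open>[0,1]\<close> are irrelevant.\<close>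

abbreviation unit_leb :: "real measure" where
  "unit_leb \<equiv> lebesgue_on {0..1}"

definition square_integrable :: "(real \<Rightarrow> real) \<Rightarrow> bool" where
  "square_integrable f \<longleftrightarrow>
     f \<in> borel_measurable unit_leb \<and> integrable unit_leb (\<lambda>x. (f x)\<^sup>2)"

definition L2_eq :: "(real \<Rightarrow> real) \<Rightarrow> (real \<Rightarrow> real) \<Rightarrow> bool" where
  "L2_eq f g \<longleftrightarrow> square_integrable f \<and> square_integrable g \<and> (AE x in unit_leb. f x = g x)"

interpretation unit_leb: finite_measure unit_leb
  by (rule finite_measure_lebesgue_on) auto

lemma square_integrable_0: "square_integrable (\<lambda>x. 0)"
  by (simp add: square_integrable_def)

quotient_type L2 = "real \<Rightarrow> real" / partial: L2_eq
proof (rule part_equivpI)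
  show "\<exists>x. L2_eq x x" using square_integrable_0 by (auto simp: L2_eq_def)
  show "symp L2_eq" by (rule sympI) (auto simp: L2_eq_def elim: AE_mp)
  show "transp L2_eq"
  proof (rule transpI)
    fix f g h assume "L2_eq f g" "L2_eq g h"
    then show "L2_eq f h"
      unfolding L2_eq_def by (auto elim!: eventually_elim2)
  qed
qed

lemma square_integrable_mult:
  assumes "square_integrable f" "square_integrable g"
  shows "integrable unit_leb (\<lambda>x. f x * g x)"
proof (rule Bochner_Integration.integrable_bound)
  show "integrable unit_leb (\<lambda>x. (f x)\<^sup>2 + (g x)\<^sup>2)"
    using assms by (auto simp: square_integrable_def)
  show "(\<lambda>x. f x * g x) \<in> borel_measurable unit_leb"
    using assms by (auto simp: square_integrable_def)
  have "\<bar>a * b\<bar> \<le> a\<^sup>2 + b\<^sup>2" for a b :: real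
  proof -
    have "2 * \<bar>a\<bar> * \<bar>b\<bar> \<le> \<bar>a\<bar>\<^sup>2 + \<bar>b\<bar>\<^sup>2" by (rule sum_squares_bound)
    moreover have "0 \<le> \<bar>a\<bar> * \<bar>b\<bar>" by simp
    ultimately show ?thesis unfolding abs_mult power2_abs by linarith
  qed
  then show "AE x in unit_leb. norm (f x * g x) \<le> norm ((f x)\<^sup>2 + (g x)\<^sup>2)"
    by auto
qed

lemma square_integrable_add:
  assumes "square_integrable f" "square_integrable g"
  shows "square_integrable (\<lambda>x. f x + g x)"
  using assms square_integrable_mult[OF assms]
  by (auto simp: square_integrable_def power2_sum mult.assoc)

lemma square_integrable_scale:
  assumes "square_integrable f"
  shows "square_integrable (\<lambda>x. c * f x)"
  using assms by (auto simp: square_integrable_def power_mult_distrib)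

lemma square_integrable_uminus:
  assumes "square_integrable f"
  shows "square_integrable (\<lambda>x. - f x)"
  using assms by (auto simp: square_integrable_def)

lemma square_integrable_diff:
  assumes "square_integrable f" "square_integrable g"
  shows "square_integrable (\<lambda>x. f x - g x)"
  using square_integrable_add[OF assms(1) square_integrable_uminus[OF assms(2)]] by simp

instantiation L2 :: real_inner
begin

lift_definition zero_L2 :: L2 is "\<lambda>x. 0"
  by (auto simp: L2_eq_def square_integrable_0)

lift_definition plus_L2 :: "L2 \<Rightarrow> L2 \<Rightarrow> L2" is "\<lambda>f g x. f x + g x"
  by (auto simp: L2_eq_def square_integrable_add elim!: eventually_elim2)

lift_definition minus_L2 :: "L2 \<Rightarrow> L2 \<Rightarrow> L2" is "\<lambda>f g x. f x - g x"
  by (auto simp: L2_eq_def square_integrable_diff elim!: eventually_elim2)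

lift_definition uminus_L2 :: "L2 \<Rightarrow> L2" is "\<lambda>f x. - f x"
  by (auto simp: L2_eq_def square_integrable_uminus elim!: eventually_mono)

lift_definition scaleR_L2 :: "real \<Rightarrow> L2 \<Rightarrow> L2" is "\<lambda>c f x. c * f x"
  by (auto simp: L2_eq_def square_integrable_scale elim!: eventually_mono)

lift_definition inner_L2 :: "L2 \<Rightarrow> L2 \<Rightarrow> real" is "\<lambda>f g. LINT x|unit_leb. f x * g x"
proof -
  fix f f' g g' assume *: "L2_eq f f'" "L2_eq g g'"
  then show "(LINT x|unit_leb. f x * g x) = (LINT x|unit_leb. f' x * g' x)"
    by (intro integral_cong_AE)
       (auto simp: L2_eq_def square_integrable_def elim!: eventually_elim2)
qed

definition norm_L2 :: "L2 \<Rightarrow> real" where "norm_L2 z = sqrt (z \<bullet> z)"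
definition sgn_L2 :: "L2 \<Rightarrow> L2" where "sgn_L2 z = scaleR (inverse (norm z)) z"
definition dist_L2 :: "L2 \<Rightarrow> L2 \<Rightarrow> real" where "dist_L2 z w = norm (z - w)"
definition uniformity_L2 :: "(L2 \<times> L2) filter" where
  "uniformity_L2 = (INF e\<in>{0 <..}. principal {(x, y). dist x y < e})"
definition open_L2 :: "L2 set \<Rightarrow> bool" where
  "open_L2 U = (\<forall>x\<in>U. eventually (\<lambda>(x', y). x' = x \<longrightarrow> y \<in> U) uniformity)"

instance
proof
  fix x y z :: L2 and a b :: real and U :: "L2 set"
  show "x + y + z = x + (y + z)"
    by transfer (auto simp: L2_eq_def add.assoc intro: square_integrable_add)
  show "x + y = y + x"
    by transfer (auto simp: L2_eq_def add.commute intro: square_integrable_add)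
  show "0 + x = x"
    by transfer (auto simp: L2_eq_def)
  show "- x + x = 0"
    by transfer (auto simp: L2_eq_def square_integrable_0)
  show "x - y = x + - y"
    by transfer (auto simp: L2_eq_def intro: square_integrable_diff)
  show "a *\<^sub>R (x + y) = a *\<^sub>R x + a *\<^sub>R y"
    by transfer (auto simp: L2_eq_def ring_distribs
        intro!: square_integrable_add square_integrable_scale)
  show "(a + b) *\<^sub>R x = a *\<^sub>R x + b *\<^sub>R x"
    by transfer (auto simp: L2_eq_def ring_distribs
        intro!: square_integrable_add square_integrable_scale)
  show "a *\<^sub>R b *\<^sub>R x = (a * b) *\<^sub>R x"
    by transfer (auto simp: L2_eq_def mult.assoc[symmetric] intro: square_integrable_scale)
  show "1 *\<^sub>R x = x"
    by transfer (auto simp: L2_eq_def)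
  show "dist x y = norm (x - y)" "sgn x = inverse (norm x) *\<^sub>R x" "norm x = sqrt (x \<bullet> x)"
    "uniformity = (INF e\<in>{0 <..}. principal {(x::L2, y). dist x y < e})"
    "open U = (\<forall>x\<in>U. eventually (\<lambda>(x', y). x' = x \<longrightarrow> y \<in> U) uniformity)"
    by (simp_all add: dist_L2_def sgn_L2_def norm_L2_def uniformity_L2_def open_L2_def)
  show "x \<bullet> y = y \<bullet> x"
    by transfer (simp add: mult.commute)
  show "(x + y) \<bullet> z = x \<bullet> z + y \<bullet> z"
    by transfer (auto simp: L2_eq_def ring_distribs square_integrable_mult)
  show "(a *\<^sub>R x) \<bullet> y = a * (x \<bullet> y)"
    by transfer (auto simp: L2_eq_def mult.assoc square_integrable_mult)
  show "0 \<le> x \<bullet> x"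
    by transfer simp
  show "(x \<bullet> x = 0) = (x = 0)"
    by transfer (auto simp: L2_eq_def square_integrable_0 square_integrable_def power2_eq_square
        integral_nonneg_eq_0_iff_AE)
qed

end

lemma L2_abs_cases:
  obtains f where "square_integrable f" "z = abs_L2 f"
  using Quotient_rep_reflp[OF Quotient_L2, of z] Quotient_abs_rep[OF Quotient_L2, of z]
  by (metis L2_eq_def)

lemma norm_diff_abs_L2:
  assumes "square_integrable f" "square_integrable g"
  shows "norm (abs_L2 f - abs_L2 g) = sqrt (LINT x|unit_leb. (f x - g x)\<^sup>2)"
proof -
  have "abs_L2 f - abs_L2 g = abs_L2 (\<lambda>x. f x - g x)"
    using assms by (intro minus_L2.abs_eq) (auto simp: L2_eq_def)
  then show ?thesis
    using assms square_integrable_diff[OF assms]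
    by (simp add: norm_L2_def inner_L2.abs_eq L2_eq_def power2_eq_square)
qed

instance L2 :: banach
proof
  fix X :: "nat \<Rightarrow> L2"
  assume X: "Cauchy X"
  have "\<forall>n. \<exists>f. square_integrable f \<and> X n = abs_L2 f" by (metis L2_abs_cases)
  then obtain F where F: "\<And>n. square_integrable (F n)" "\<And>n. X n = abs_L2 (F n)" by metis
  have [measurable]: "F n \<in> borel_measurable unit_leb" for n
    using F(1) by (auto simp: square_integrable_def)
  have "\<forall>k. \<exists>N. \<forall>m\<ge>N. \<forall>n\<ge>N. norm (X m - X n) < (1/2)^k"
    using X by (auto simp: Cauchy_iff)
  then obtain N where N: "\<And>k m n. N k \<le> m \<Longrightarrow> N k \<le> n \<Longrightarrow> norm (X m - X n) < (1/2)^k"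
    by metis
  define r where "r k = Max (N ` {..k})" for k
  have r: "N j \<le> r k" if "j \<le> k" for j k
    unfolding r_def using that by (intro Max_ge) auto
  have L: "norm (X (r j) - X (r k)) < (1/2)^k" if "k \<le> j" for j k
    using N[of k "r j" "r k"] r that by auto
  define d where "d k x = \<bar>F (r (Suc k)) x - F (r k) x\<bar>" for k x
  have d: "(\<integral>\<^sup>+x. ennreal (d k x) \<partial>unit_leb) \<le> ennreal ((1/2)^k)" for k
  proof -
    let ?D = "\<lambda>x. F (r (Suc k)) x - F (r k) x"
    have sq: "square_integrable ?D" by (intro square_integrable_diff F)
    have i: "integrable unit_leb ?D"
      using sq by (auto intro!: unit_leb.square_integrable_imp_integrable simp: square_integrable_def)
    have [simp]: "square_integrable (\<lambda>_. 1)" by (simp add: square_integrable_def)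
    have [simp]: "square_integrable (\<lambda>x. \<bar>?D x\<bar>)"
      using sq by (auto simp: square_integrable_def)
    have "(LINT x|unit_leb. \<bar>?D x\<bar>) = abs_L2 (\<lambda>x. \<bar>?D x\<bar>) \<bullet> abs_L2 (\<lambda>_. 1)"
      by (subst inner_L2.abs_eq) (auto simp: L2_eq_def)
    also have "\<dots> \<le> norm (abs_L2 (\<lambda>x. \<bar>?D x\<bar>)) * norm (abs_L2 (\<lambda>_. 1))"
      by (rule norm_cauchy_schwarz)
    also have "norm (abs_L2 (\<lambda>_. 1)) = 1"
      by (simp add: norm_L2_def inner_L2.abs_eq L2_eq_def measure_restrict_space)
    also have "norm (abs_L2 (\<lambda>x. \<bar>?D x\<bar>)) = norm (X (r (Suc k)) - X (r k))"
      unfolding F(2) norm_diff_abs_L2[OF F(1) F(1)]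
      by (simp add: norm_L2_def inner_L2.abs_eq L2_eq_def power2_eq_square)
    finally have "(LINT x|unit_leb. d k x) \<le> (1/2)^k"
      using L[of k "Suc k"] by (simp add: d_def)
    then show ?thesis
      using i by (subst nn_integral_eq_integral) (auto simp: d_def[abs_def] intro: ennreal_leI)
  qed
  have [measurable]: "d k \<in> borel_measurable unit_leb" for k
    unfolding d_def[abs_def] by measurable
  have "(\<integral>\<^sup>+x. (\<Sum>k. ennreal (d k x)) \<partial>unit_leb) = (\<Sum>k. \<integral>\<^sup>+x. ennreal (d k x) \<partial>unit_leb)"
    by (intro nn_integral_suminf) measurable
  also have "\<dots> \<le> (\<Sum>k. ennreal ((1/2)^k))" by (intro suminf_le d) auto
  also have "\<dots> < \<infinity>"
    by (subst suminf_ennreal2) auto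
  finally have "AE x in unit_leb. (\<Sum>k. ennreal (d k x)) \<noteq> \<infinity>"
    by (intro nn_integral_PInf_AE) auto
  then have conv: "AE x in unit_leb. convergent (\<lambda>k. F (r k) x)"
  proof eventually_elim
    case (elim x)
    have "summable (\<lambda>k. d k x)"
      using elim by (intro summable_suminf_not_top) (auto simp: d_def)
    then have "summable (\<lambda>k. F (r (Suc k)) x - F (r k) x)"
      by (auto simp: d_def intro: summable_rabs_cancel)
    then have "convergent (\<lambda>n. \<Sum>k<n. F (r (Suc k)) x - F (r k) x)"
      by (simp add: summable_iff_convergent)
    then have "convergent (\<lambda>n. F (r n) x - F (r 0) x)"
      by (simp add: sum_lessThan_telescope[of "\<lambda>k. F (r k) x"])
    from convergent_add[OF this convergent_const[of "F (r 0) x"]] show ?case by simp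
  qed
  define f where "f x = lim (\<lambda>k. F (r k) x)" for x
  have [measurable]: "f \<in> borel_measurable unit_leb"
    unfolding f_def[abs_def] by measurable
  have bound: "(\<integral>\<^sup>+x. ennreal ((f x - F (r k) x)\<^sup>2) \<partial>unit_leb) \<le> ennreal (((1/2)^k)\<^sup>2)" for k
  proof -
    have "(\<integral>\<^sup>+x. ennreal ((f x - F (r k) x)\<^sup>2) \<partial>unit_leb)
        = (\<integral>\<^sup>+x. liminf (\<lambda>j. ennreal ((F (r j) x - F (r k) x)\<^sup>2)) \<partial>unit_leb)"
    proof (rule nn_integral_cong_AE)
      show "AE x in unit_leb. ennreal ((f x - F (r k) x)\<^sup>2)
          = liminf (\<lambda>j. ennreal ((F (r j) x - F (r k) x)\<^sup>2))"
        using conv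
      proof eventually_elim
        case (elim x)
        then have "(\<lambda>j. F (r j) x) \<longlonglongrightarrow> f x" by (simp add: f_def convergent_LIMSEQ_iff)
        then have "(\<lambda>j. ennreal ((F (r j) x - F (r k) x)\<^sup>2)) \<longlonglongrightarrow> ennreal ((f x - F (r k) x)\<^sup>2)"
          by (intro tendsto_intros)
        from lim_imp_Liminf[OF _ this] show ?case by simp
      qed
    qed
    also have "\<dots> \<le> liminf (\<lambda>j. \<integral>\<^sup>+x. ennreal ((F (r j) x - F (r k) x)\<^sup>2) \<partial>unit_leb)"
      by (intro nn_integral_liminf) measurable
    also have "\<dots> \<le> liminf (\<lambda>j. ennreal (((1/2)^k)\<^sup>2))"
    proof (rule Liminf_mono, rule eventually_sequentiallyI[of k])
      fix j assume "k \<le> j"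
      have "square_integrable (\<lambda>x. F (r j) x - F (r k) x)" by (intro square_integrable_diff F)
      then have "(\<integral>\<^sup>+x. ennreal ((F (r j) x - F (r k) x)\<^sup>2) \<partial>unit_leb)
          = ennreal ((norm (X (r j) - X (r k)))\<^sup>2)"
        unfolding F(2) norm_diff_abs_L2[OF F(1) F(1)]
        by (subst nn_integral_eq_integral) (auto simp: square_integrable_def)
      also have "\<dots> \<le> ennreal (((1/2)^k)\<^sup>2)"
        using L[OF \<open>k \<le> j\<close>] by (intro ennreal_leI power_mono) auto
      finally show "(\<integral>\<^sup>+x. ennreal ((F (r j) x - F (r k) x)\<^sup>2) \<partial>unit_leb) \<le> ennreal (((1/2)^k)\<^sup>2)" .
    qed
    also have "\<dots> = ennreal (((1/2)^k)\<^sup>2)" by (simp add: Liminf_const)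
    finally show ?thesis .
  qed
  have sqd: "square_integrable (\<lambda>x. f x - F (r k) x)" for k
    unfolding square_integrable_def
  proof
    show "integrable unit_leb (\<lambda>x. (f x - F (r k) x)\<^sup>2)"
      using bound[of k] by (intro integrableI_bounded) (auto simp: le_less_trans)
  qed measurable
  have sqf: "square_integrable f"
    using square_integrable_add[OF sqd[of 0] F(1)[of "r 0"]] by simp
  have "norm (X (r k) - abs_L2 f) \<le> (1/2)^k" for k
  proof -
    have "ennreal (LINT x|unit_leb. (f x - F (r k) x)\<^sup>2) \<le> ennreal (((1/2)^k)\<^sup>2)"
      using bound[of k] sqd[of k]
      by (subst (asm) nn_integral_eq_integral) (auto simp: square_integrable_def)
    then have "(LINT x|unit_leb. (f x - F (r k) x)\<^sup>2) \<le> ((1/2)^k)\<^sup>2"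
      by (simp add: ennreal_le_iff)
    then have "sqrt (LINT x|unit_leb. (f x - F (r k) x)\<^sup>2) \<le> (1/2)^k"
      by (simp add: real_le_lsqrt)
    then show ?thesis
      unfolding F(2) norm_minus_commute[of _ "abs_L2 f"] norm_diff_abs_L2[OF sqf F(1)] .
  qed
  note close = this
  have "X \<longlonglongrightarrow> abs_L2 f"
  proof (rule LIMSEQ_I)
    fix e :: real assume "0 < e"
    then obtain k where k: "(1/2::real)^k < e / 2"
      using real_arch_pow_inv[of "e/2" "1/2"] by auto
    have "norm (X n - abs_L2 f) < e" if "N k \<le> n" for n
    proof -
      have "norm (X n - abs_L2 f) \<le> norm (X n - X (r k)) + norm (X (r k) - abs_L2 f)"
        by (metis diff_add_cancel add_diff_eq norm_triangle_ineq)
      then show ?thesis using N[of k n "r k"] r[of k k] close[of k] that k by simp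
    qed
    then show "\<exists>no. \<forall>n\<ge>no. norm (X n - abs_L2 f) < e" by blast
  qed
  then show "convergent X" by (rule convergentI)
qed


section \<open>Strongly continuous semigroups\<close>

definition C0_semigroup :: "(real \<Rightarrow> 'a::banach \<Rightarrow> 'a) \<Rightarrow> bool" where
  "C0_semigroup S \<longleftrightarrow>
     (\<forall>t\<ge>0. bounded_linear (S t)) \<and>
     S 0 = id \<and>
     (\<forall>s\<ge>0. \<forall>t\<ge>0. S (s + t) = S s \<circ> S t) \<and>
     (\<forall>z. ((\<lambda>t. S t z) \<longlongrightarrow> z) (at_right 0))"

text \<open>
  Unbounded operators are identified with their graphs, so an equation between two of them
  includes the equality of the domains.
\<close>

definition generator :: "(real \<Rightarrow> 'a::banach \<Rightarrow> 'a) \<Rightarrow> ('a \<times> 'a) set" where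
  "generator S = {(z, w). ((\<lambda>h. (S h z - z) /\<^sub>R h) \<longlongrightarrow> w) (at_right 0)}"


section \<open>Sobolev spaces on \<open>(0,1)\<close> and the Dirichlet Laplacian\<close>

text \<open>
  The class \<open>C\<^sub>c\<^sup>\<infinity>(0,1)\<close>, its members being extended by zero to the whole line. The support is a
  closed subset of the bounded interval \<open>(0,1)\<close>, hence compact.
\<close>

definition test_function :: "(real \<Rightarrow> real) \<Rightarrow> bool" where
  "test_function \<phi> \<longleftrightarrow>
     (\<forall>k x. (deriv ^^ k) \<phi> field_differentiable at x) \<and>
     closure {x. \<phi> x \<noteq> 0} \<subseteq> {0<..<1}"

lemma square_integrable_test_function:
  assumes "test_function \<phi>"
  shows "square_integrable ((deriv ^^ k) \<phi>)"
proof -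
  have "continuous_on {0..1} ((deriv ^^ k) \<phi>)"
    using assms
    by (auto simp: test_function_def
        intro!: continuous_at_imp_continuous_on field_differentiable_imp_continuous_at)
  then show ?thesis
    unfolding square_integrable_def
    by (auto intro!: continuous_imp_measurable_on_sets_lebesgue continuous_imp_integrable_real
        continuous_on_power)
qed

text \<open>
  The inner products below are the integrals \<open>\<integral> z \<phi>\<^sup>(\<^sup>k\<^sup>)\<close> and \<open>\<integral> w \<phi>\<close> over \<open>[0,1]\<close>.
\<close>

definition weak_derivative :: "nat \<Rightarrow> L2 \<Rightarrow> L2 \<Rightarrow> bool" where
  "weak_derivative k z w \<longleftrightarrow>
     (\<forall>\<phi>. test_function \<phi> \<longrightarrow>
        z \<bullet> abs_L2 ((deriv ^^ k) \<phi>) = (- 1) ^ k * (w \<bullet> abs_L2 \<phi>))"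

definition sobolev_H :: "nat \<Rightarrow> L2 set" where
  "sobolev_H k = {z. \<forall>j\<le>k. \<exists>w. weak_derivative j z w}"

text \<open>\<open>H\<^sup>1\<^sub>0(0,1)\<close> is the closure of the test functions in the norm of \<open>H\<^sup>1(0,1)\<close>.\<close>

definition sobolev_H10 :: "L2 set" where
  "sobolev_H10 = {z \<in> sobolev_H 1. \<exists>w \<phi>. weak_derivative 1 z w \<and> (\<forall>j. test_function (\<phi> j)) \<and>
     (\<lambda>j::nat. abs_L2 (\<phi> j)) \<longlonglongrightarrow> z \<and> (\<lambda>j. abs_L2 (deriv (\<phi> j))) \<longlonglongrightarrow> w}"

definition heat_operator :: "real \<Rightarrow> (L2 \<times> L2) set" where
  "heat_operator \<alpha> =
     {(z, \<alpha> *\<^sub>R w) | z w. z \<in> sobolev_H 2 \<inter> sobolev_H10 \<and> weak_derivative 2 z w}"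


section \<open>Banach spaces with explicit carrier\<close>

text \<open>
  The spaces \<open>Z\<^sub>n\<close> change with \<open>n\<close>, so they cannot all be types. Normed spaces are therefore
  also represented as records, namely modules over the reals together with a norm; the
  multiplicative fields that a \<^typ>\<open>(real, 'b) module\<close> inherits from rings are unused.
\<close>

record 'b normed_module = "(real, 'b) module" +
  nrm :: "'b \<Rightarrow> real"

definition banach_space :: "'b normed_module \<Rightarrow> bool" where
  "banach_space V \<longleftrightarrow>
     vectorspace class_ring V \<and>
     (\<forall>v\<in>carrier V. 0 \<le> nrm V v \<and> (nrm V v = 0 \<longleftrightarrow> v = \<zero>\<^bsub>V\<^esub>)) \<and>
     (\<forall>a. \<forall>v\<in>carrier V. nrm V (a \<odot>\<^bsub>V\<^esub> v) = \<bar>a\<bar> * nrm V v) \<and>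
     (\<forall>v\<in>carrier V. \<forall>w\<in>carrier V. nrm V (v \<oplus>\<^bsub>V\<^esub> w) \<le> nrm V v + nrm V w) \<and>
     (\<forall>X::nat \<Rightarrow> 'b. range X \<subseteq> carrier V \<longrightarrow>
        (\<forall>e>0. \<exists>N. \<forall>m\<ge>N. \<forall>n\<ge>N. nrm V (X m \<ominus>\<^bsub>V\<^esub> X n) < e) \<longrightarrow>
        (\<exists>v\<in>carrier V. (\<lambda>n. nrm V (X n \<ominus>\<^bsub>V\<^esub> v)) \<longlonglongrightarrow> 0))"

definition type_space :: "'a::real_normed_vector normed_module" where
  "type_space = \<lparr>carrier = UNIV, mult = undefined, one = undefined,
     zero = 0, add = (+), smult = (*\<^sub>R), nrm = norm\<rparr>"

definition bounded_operator ::
    "'a normed_module \<Rightarrow> 'b normed_module \<Rightarrow> ('a \<Rightarrow> 'b) \<Rightarrow> bool" where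
  "bounded_operator V W T \<longleftrightarrow>
     linear_map class_ring V W T \<and> (\<exists>K. \<forall>v\<in>carrier V. nrm W (T v) \<le> K * nrm V v)"

text \<open>The analogue of \<^const>\<open>onorm\<close>; a possible \<open>v = 0\<close> contributes \<open>0 / 0 = 0\<close>.\<close>

definition op_norm ::
    "'a normed_module \<Rightarrow> 'b normed_module \<Rightarrow> ('a \<Rightarrow> 'b) \<Rightarrow> real" where
  "op_norm V W T = (SUP v\<in>carrier V. nrm W (T v) / nrm V v)"


section \<open>Approximation sequences\<close>

text \<open>Sequences indexed by \<open>n \<ge> 1\<close> are functions on \<^typ>\<open>nat\<close> whose value at \<open>0\<close> is irrelevant.\<close>

definition approximation_sequence ::
    "(nat \<Rightarrow> 'b normed_module) \<Rightarrow> (nat \<Rightarrow> 'a::banach \<Rightarrow> 'b) \<Rightarrow> (nat \<Rightarrow> 'b \<Rightarrow> 'a)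
      \<Rightarrow> real \<Rightarrow> real \<Rightarrow> bool" where
  "approximation_sequence Zs P E \<mu>p \<mu>e \<longleftrightarrow>
     (\<forall>n\<ge>1. banach_space (Zs n) \<and>
            bounded_operator type_space (Zs n) (P n) \<and>
            bounded_operator (Zs n) type_space (E n) \<and>
            (\<forall>v\<in>carrier (Zs n). P n (E n v) = v)) \<and>
     (\<forall>z. (\<lambda>n. nrm (Zs n) (P n z)) \<longlonglongrightarrow> norm z) \<and>
     0 < \<mu>p \<and> 0 < \<mu>e \<and>
     (\<forall>n\<ge>1. op_norm type_space (Zs n) (P n) \<le> \<mu>p \<and> op_norm (Zs n) type_space (E n) \<le> \<mu>e)"

definition vectors_converge ::
    "(nat \<Rightarrow> 'b normed_module) \<Rightarrow> (nat \<Rightarrow> 'a::banach \<Rightarrow> 'b) \<Rightarrow> (nat \<Rightarrow> 'b) \<Rightarrow> 'a \<Rightarrow> bool" where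
  "vectors_converge Zs P zs z \<longleftrightarrow> (\<lambda>n. nrm (Zs n) (P n z \<ominus>\<^bsub>Zs n\<^esub> zs n)) \<longlonglongrightarrow> 0"

definition semigroups_converge ::
    "(nat \<Rightarrow> 'b normed_module) \<Rightarrow> (nat \<Rightarrow> 'a::banach \<Rightarrow> 'b) \<Rightarrow> (nat \<Rightarrow> 'b \<Rightarrow> 'a)
      \<Rightarrow> (nat \<Rightarrow> real \<Rightarrow> 'b \<Rightarrow> 'b) \<Rightarrow> (real \<Rightarrow> 'a \<Rightarrow> 'a) \<Rightarrow> bool" where
  "semigroups_converge Zs P E Ss S \<longleftrightarrow>
     (\<forall>t\<ge>0. \<forall>zs z. (\<forall>n\<ge>1. zs n \<in> carrier (Zs n)) \<longrightarrow> vectors_converge Zs P zs z \<longrightarrow>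
        (\<lambda>n. E n (Ss n t (zs n))) \<longlonglongrightarrow> S t z)"


section \<open>The finite-difference discretization\<close>

definition mesh :: "nat \<Rightarrow> real" where
  "mesh n = 1 / (real n + 1)"

definition node :: "nat \<Rightarrow> nat \<Rightarrow> real" where
  "node n k = real k * mesh n"

text \<open>
  Entries of a \<^typ>\<open>real Matrix.vec\<close> are numbered from \<open>0\<close>: entry \<open>i\<close> belongs to \<^term>\<open>node n (i + 1)\<close>.
\<close>

definition grid_inner :: "nat \<Rightarrow> real Matrix.vec \<Rightarrow> real Matrix.vec \<Rightarrow> real" where
  "grid_inner n v w = mesh n * (\<Sum>i<n. v $ i * w $ i)"

definition grid_space :: "nat \<Rightarrow> real Matrix.vec normed_module" where
  "grid_space n = \<lparr>carrier = carrier_vec n, mult = undefined, one = undefined,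
     zero = 0\<^sub>v n, add = (+), smult = (\<cdot>\<^sub>v), nrm = (\<lambda>v. sqrt (grid_inner n v v))\<rparr>"

lemma cell_subset:
  assumes "1 \<le> k" "k \<le> n"
  shows "{node n k - mesh n / 2 .. node n k + mesh n / 2} \<subseteq> {0..1}"
proof -
  have "mesh n > 0" by (simp add: mesh_def)
  moreover have "1 * mesh n \<le> real k * mesh n" "real k * mesh n \<le> real n * mesh n"
    using assms \<open>mesh n > 0\<close> by (intro mult_right_mono; simp)+
  moreover have "real n * mesh n + mesh n = 1" by (simp add: mesh_def field_simps)
  ultimately show ?thesis unfolding node_def atLeastatMost_subset_iff by linarith
qed

lift_definition grid_proj :: "nat \<Rightarrow> L2 \<Rightarrow> real Matrix.vec" is
  "\<lambda>n z. Matrix.vec n (\<lambda>i. 1 / mesh n *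
     (LINT s|lebesgue_on {node n (i+1) - mesh n / 2 .. node n (i+1) + mesh n / 2}. z s))"
proof -
  fix n and f g :: "real \<Rightarrow> real" assume fg: "L2_eq f g"
  have "(LINT s|lebesgue_on {node n (i+1) - mesh n / 2 .. node n (i+1) + mesh n / 2}. f s)
      = (LINT s|lebesgue_on {node n (i+1) - mesh n / 2 .. node n (i+1) + mesh n / 2}. g s)"
    (is "(LINT s|lebesgue_on ?I. _) = _") if "i < n" for i
  proof (rule integral_cong_AE)
    have I: "?I \<subseteq> {0..1}" using cell_subset[of "i+1" n] that by simp
    then show "f \<in> borel_measurable (lebesgue_on ?I)" "g \<in> borel_measurable (lebesgue_on ?I)"
      using fg by (auto simp only: L2_eq_def square_integrable_def intro: measurable_restrict_mono)
    show "AE s in lebesgue_on ?I. f s = g s"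
      using fg I by (auto simp: L2_eq_def AE_restrict_space_iff elim!: eventually_mono)
  qed
  then show "Matrix.vec n (\<lambda>i. 1 / mesh n *
      (LINT s|lebesgue_on {node n (i+1) - mesh n / 2 .. node n (i+1) + mesh n / 2}. f s))
    = Matrix.vec n (\<lambda>i. 1 / mesh n *
      (LINT s|lebesgue_on {node n (i+1) - mesh n / 2 .. node n (i+1) + mesh n / 2}. g s))"
    by (intro eq_vecI) auto
qed

lift_definition grid_embed :: "nat \<Rightarrow> real Matrix.vec \<Rightarrow> L2" is
  "\<lambda>n v x. \<Sum>i<n. v $ i *
     indicator {node n (i+1) - mesh n / 2 ..< node n (i+1) + mesh n / 2} x"
proof -
  fix n and v :: "real Matrix.vec"
  have meas: "(indicator {a..<b} :: real \<Rightarrow> real) \<in> borel_measurable unit_leb" for a b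
    by (intro measurable_restrict_space1 borel_measurable_indicator) simp
  then have meas2: "(\<lambda>x. (indicator {a..<b} x :: real)\<^sup>2) \<in> borel_measurable unit_leb" for a b
    by (rule borel_measurable_power)
  have ind: "square_integrable (indicator {a..<b})" for a b :: real
    unfolding square_integrable_def
  proof
    show "integrable unit_leb (\<lambda>x. (indicator {a..<b} x :: real)\<^sup>2)"
      by (intro unit_leb.integrable_const_bound[where B=1])
         (simp_all add: meas2 power_le_one indicator_le_1)
  qed (rule meas)
  have "square_integrable (\<lambda>x. \<Sum>i<m. v $ i * indicator {a i..<b i} x)"
    for m and a b :: "nat \<Rightarrow> real"
  proof (induction m)
    case 0
    then show ?case by (simp add: square_integrable_0)
  next
    case (Suc m)
    show ?case
      unfolding sum.lessThan_Suc
      by (rule square_integrable_add[OF Suc square_integrable_scale[OF ind]])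
  qed
  then show "L2_eq
    (\<lambda>x. \<Sum>i<n. v $ i * indicator {node n (i+1) - mesh n / 2 ..< node n (i+1) + mesh n / 2} x)
    (\<lambda>x. \<Sum>i<n. v $ i * indicator {node n (i+1) - mesh n / 2 ..< node n (i+1) + mesh n / 2} x)"
    by (simp add: L2_eq_def)
qed

definition grid_laplacian :: "real \<Rightarrow> nat \<Rightarrow> real Matrix.mat" where
  "grid_laplacian \<alpha> n = Matrix.mat n n (\<lambda>(i, j).
     if i = j then - 2 * \<alpha> / (mesh n)\<^sup>2
     else if i = j + 1 \<or> j = i + 1 then \<alpha> / (mesh n)\<^sup>2
     else 0)"

text \<open>The exponential series of a square matrix, which converges in every entry.\<close>

definition mat_exp :: "real Matrix.mat \<Rightarrow> real Matrix.mat" where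
  "mat_exp A = Matrix.mat (dim_row A) (dim_row A) (\<lambda>(i, j). \<Sum>k. (A ^\<^sub>m k) $$ (i, j) / fact k)"

definition grid_semigroup ::
    "real \<Rightarrow> nat \<Rightarrow> real \<Rightarrow> real Matrix.vec \<Rightarrow> real Matrix.vec" where
  "grid_semigroup \<alpha> n t v = mat_exp (t \<cdot>\<^sub>m grid_laplacian \<alpha> n) *\<^sub>v v"

end

theory Submission
  imports Defs
begin

text \<open>
  The functions \<open>e\<^sub>k(x) = sin (k \<pi> x)\<close> diagonalise both evolutions. On the grid, the vector of the
  values of \<open>e\<^sub>k\<close> at the nodes is an eigenvector of the difference matrix: this is the addition
  theorem for the sine at interior nodes, and the missing neighbours of the first and last node
  are harmless because \<open>e\<^sub>k\<close> vanishes at \<open>0\<close> and \<open>1\<close>. The eigenvalue is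
  \<open>- \<alpha> (2 (n + 1) sin (k \<pi> / (2 (n + 1))))\<^sup>2\<close>, which tends to \<open>- \<alpha> k\<^sup>2 \<pi>\<^sup>2\<close> from above; for \<open>k = 1\<close>
  it is \<open>\<omega>\<^sub>n\<close>. In \<open>L\<^sup>2\<close> the function \<open>e\<^sub>k\<close> belongs to the domain of the generator, with the
  eigenvalue \<open>- \<alpha> k\<^sup>2 \<pi>\<^sup>2\<close>. So both evolutions multiply their versions of \<open>e\<^sub>k\<close> by exponentials,
  the exponents converge, and the step functions with the node values of \<open>e\<^sub>k\<close> converge to \<open>e\<^sub>k\<close>.
  This is the convergence of the semigroups on \<open>e\<^sub>k\<close>, and it extends to all initial values because
  the maps \<open>z \<mapsto> E\<^sub>n S\<^sub>n(t) P\<^sub>n z\<close> are contractions (lemma \<open>equibounded_convergence_on_dense_span\<close>) and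
  the sines span a dense subspace (lemma \<open>sines_dense\<close>).

  The contraction property has two sources. Taking cell averages is the adjoint of forming step
  functions, and the latter is isometric; this gives \<open>\<parallel>P\<^sub>n\<parallel> \<le> 1\<close>, the identity \<open>P\<^sub>n E\<^sub>n = id\<close>,
  linearity of \<open>P\<^sub>n\<close> and completeness of the grid spaces. The difference matrix is symmetric, with
  nonnegative entries off the diagonal and row sums at most \<open>0\<close>, hence negative semidefinite; so
  the squared norm does not increase along the solutions of the linear differential equation
  (lemma \<open>mat_exp_contraction\<close>). The convergence \<open>\<parallel>P\<^sub>n z\<parallel> \<rightarrow> \<parallel>z\<parallel>\<close> is the case \<open>\<alpha> = 0\<close>, \<open>t = 0\<close> of
  the convergence of the evolutions, which then reads \<open>E\<^sub>n P\<^sub>n z \<rightarrow> z\<close>.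

  Two facts about the limit are less immediate. The semigroup \<open>S\<close> is known only through its
  generator, so \<open>S(t) e\<^sub>k\<close> has to be computed from the derivative at \<open>0\<close>; this needs a bound for
  \<open>\<parallel>S(s)\<parallel>\<close> with \<open>s\<close> near \<open>0\<close>, which the uniform boundedness principle provides
  (lemma \<open>C0_semigroup_eigenvector\<close>). And the Dirichlet condition is expressed by approximation with
  test functions, so each \<open>e\<^sub>k\<close> must be approximated in \<open>H\<^sup>1\<close> by smooth functions with compact support
  in \<open>(0,1)\<close>. Multiplying by cutoffs that act in layers of width \<open>1/n\<close> at the end points does this: the
  derivative of the cutoff has size \<open>n\<close> there, but \<open>e\<^sub>k\<close> has size \<open>1/n\<close>.
\<close>

section \<open>Dominated convergence in \<open>L\<^sup>2\<close>\<close>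

lemma abs_L2_add:
  assumes "square_integrable f" "square_integrable g"
  shows "abs_L2 (\<lambda>x. f x + g x) = abs_L2 f + abs_L2 g"
  using assms by (subst plus_L2.abs_eq) (auto simp: L2_eq_def)

lemma abs_L2_scale:
  assumes "square_integrable f"
  shows "abs_L2 (\<lambda>x. c * f x) = c *\<^sub>R abs_L2 f"
  using assms by (subst scaleR_L2.abs_eq) (auto simp: L2_eq_def)

lemma square_integrable_sum:
  assumes "\<And>i. i \<in> I \<Longrightarrow> square_integrable (f i)"
  shows "square_integrable (\<lambda>x. \<Sum>i\<in>I. f i x)"
  using assms
  by (induction I rule: infinite_finite_induct)
     (simp_all add: square_integrable_0 square_integrable_add)

lemma abs_L2_sum:
  assumes "\<And>i. i \<in> I \<Longrightarrow> square_integrable (f i)"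
  shows "abs_L2 (\<lambda>x. \<Sum>i\<in>I. f i x) = (\<Sum>i\<in>I. abs_L2 (f i))"
  using assms
  by (induction I rule: infinite_finite_induct)
     (simp_all add: zero_L2_def abs_L2_add square_integrable_sum)

lemma inner_abs_L2:
  assumes "square_integrable f" "square_integrable g"
  shows "abs_L2 f \<bullet> abs_L2 g = (LINT x|unit_leb. f x * g x)"
  using assms by (subst inner_L2.abs_eq) (auto simp: L2_eq_def)

lemma square_integrable_bounded_by:
  assumes F: "square_integrable F" and g: "g \<in> borel_measurable unit_leb"
    and le: "AE x in unit_leb. \<bar>g x\<bar> \<le> F x"
  shows "square_integrable g"
  unfolding square_integrable_def
proof
  show "integrable unit_leb (\<lambda>x. (g x)\<^sup>2)"
  proof (rule Bochner_Integration.integrable_bound)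
    show "integrable unit_leb (\<lambda>x. (F x)\<^sup>2)" using F by (simp add: square_integrable_def)
    show "(\<lambda>x. (g x)\<^sup>2) \<in> borel_measurable unit_leb" using g by simp
    show "AE x in unit_leb. norm ((g x)\<^sup>2) \<le> norm ((F x)\<^sup>2)"
      using le by eventually_elim (auto simp flip: abs_le_square_iff)
  qed
qed (rule g)

lemma square_integrable_continuous:
  assumes "continuous_on {0..1} f"
  shows "square_integrable f"
  using assms unfolding square_integrable_def
  by (auto intro!: continuous_imp_measurable_on_sets_lebesgue continuous_imp_integrable_real
      continuous_on_power)

text \<open>
  All limits in the space \<open>L\<^sup>2\<close> below are limits of explicit functions and are obtained pointwise
  almost everywhere with a square integrable majorant.
\<close>

lemma L2_dominated_convergence:
  assumes F: "square_integrable F"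
    and f: "\<And>n. f n \<in> borel_measurable unit_leb"
    and g: "g \<in> borel_measurable unit_leb"
    and le: "\<And>n. AE x in unit_leb. \<bar>f n x\<bar> \<le> F x"
    and lim: "AE x in unit_leb. (\<lambda>n. f n x) \<longlonglongrightarrow> g x"
  shows "(\<lambda>n. abs_L2 (f n)) \<longlonglongrightarrow> abs_L2 g"
proof -
  have le_all: "AE x in unit_leb. \<forall>n. \<bar>f n x\<bar> \<le> F x" using le by (simp add: AE_all_countable)
  have le_g: "AE x in unit_leb. \<bar>g x\<bar> \<le> F x"
    using le_all lim by eventually_elim (rule LIMSEQ_le_const2[OF tendsto_rabs], auto)
  have sq: "square_integrable (f n)" "square_integrable g" for n
    using square_integrable_bounded_by[OF F f le] square_integrable_bounded_by[OF F g le_g] by auto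
  have "(\<lambda>n. LINT x|unit_leb. (f n x - g x)\<^sup>2) \<longlonglongrightarrow> (LINT x|unit_leb. 0)"
  proof (rule integral_dominated_convergence)
    show "integrable unit_leb (\<lambda>x. (2 * F x)\<^sup>2)"
      using square_integrable_scale[OF F, of 2] by (simp add: square_integrable_def)
    show "AE x in unit_leb. (\<lambda>n. (f n x - g x)\<^sup>2) \<longlonglongrightarrow> 0"
      using lim by eventually_elim (auto intro!: tendsto_eq_intros)
    show "AE x in unit_leb. norm ((f n x - g x)\<^sup>2) \<le> (2 * F x)\<^sup>2" for n
      using le[of n] le_g
    proof eventually_elim
      case (elim x)
      then have "\<bar>f n x - g x\<bar> \<le> \<bar>2 * F x\<bar>" by linarith
      then show ?case by (simp only: abs_le_square_iff real_norm_def abs_power2)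
    qed
  qed (use f g in auto)
  then have "(\<lambda>n. sqrt (LINT x|unit_leb. (f n x - g x)\<^sup>2)) \<longlonglongrightarrow> sqrt 0"
    by (intro tendsto_real_sqrt) simp
  then have "(\<lambda>n. norm (abs_L2 (f n) - abs_L2 g)) \<longlonglongrightarrow> 0"
    by (simp add: norm_diff_abs_L2 sq)
  then show ?thesis by (simp add: tendsto_norm_zero_iff LIM_zero_iff)
qed

section \<open>The sines span a dense subspace\<close>

definition sine :: "nat \<Rightarrow> real \<Rightarrow> real" where
  "sine k x = sin (real k * pi * x)"

lemma square_integrable_sine_cos_power: "square_integrable (\<lambda>x. sine k x * cos (pi * x) ^ m)"
  unfolding sine_def by (intro square_integrable_continuous continuous_intros)

text \<open>
  By \<open>2 sin (k \<pi> x) cos (\<pi> x) = sin ((k + 1) \<pi> x) + sin ((k - 1) \<pi> x)\<close>, multiplication by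
  \<open>cos (\<pi> x)\<close> preserves the span of the sines.
\<close>

lemma sine_cos_power_in_span:
  "abs_L2 (\<lambda>x. sine k x * cos (pi * x) ^ m) \<in> span (range (\<lambda>k. abs_L2 (sine k)))"
proof (induction m arbitrary: k)
  case 0
  show ?case by (auto intro: span_base)
next
  case (Suc m)
  show ?case
  proof (cases k)
    case 0
    then have "(\<lambda>x. sine k x * cos (pi * x) ^ Suc m) = (\<lambda>x. 0)" by (simp add: sine_def)
    then show ?thesis by (simp add: span_zero flip: zero_L2_def)
  next
    case (Suc j)
    have prod: "sin (a + b) * cos b = 1/2 * sin (a + 2 * b) + 1/2 * sin a" for a b :: real
    proof -
      have "sin (a + 2 * b) = sin ((a + b) + b)" "sin a = sin ((a + b) - b)"
          by (simp_all add: algebra_simps)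
      then show ?thesis by (simp only: sin_add[of "a + b" b] sin_diff[of "a
          + b" b]) (simp add: algebra_simps)
    qed
    have "sine k x * cos (pi * x) = 1/2 * sine (Suc (Suc j)) x + 1/2 * sine j x" for x
      using prod[of "real j * pi * x" "pi * x"] Suc by (simp add: sine_def algebra_simps)
    then have "(\<lambda>x. sine k x * cos (pi * x) ^ Suc m) =
        (\<lambda>x. 1/2 * (sine (Suc (Suc j)) x * cos (pi * x) ^ m) + 1/2 * (sine j x * cos (pi * x) ^ m))"
      by (simp add: fun_eq_iff mult.assoc[symmetric] distrib_right)
    then have "abs_L2 (\<lambda>x. sine k x * cos (pi * x) ^ Suc m) =
        (1/2) *\<^sub>R abs_L2 (\<lambda>x. sine (Suc (Suc j)) x * cos (pi * x) ^ m) +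
        (1/2) *\<^sub>R abs_L2 (\<lambda>x. sine j x * cos (pi * x) ^ m)"
      by (simp only: abs_L2_add abs_L2_scale square_integrable_scale square_integrable_sine_cos_power)
    then show ?thesis by (simp add: Suc.IH span_add span_scale)
  qed
qed

lemma AE_unit_leb_interior: "AE x in unit_leb. 0 < x \<and> x < 1"
proof -
  have "AE x in lebesgue. x \<notin> {0, 1::real}"
    by (intro AE_not_in) (auto simp: negligible_iff_null_sets[symmetric])
  then show ?thesis
    by (subst AE_restrict_space_iff, simp, eventually_elim) auto
qed
lemma measurable_continuous_unit_leb:
  fixes f :: "real \<Rightarrow> real"
  assumes "continuous_on {0..1} f"
  shows "f \<in> borel_measurable unit_leb"
  using square_integrable_continuous[OF assms] by (simp add: square_integrable_def)

definition sine_closure :: "L2 set" where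
  "sine_closure = closure (span (range (\<lambda>k. abs_L2 (sine k))))"

lemma sine_closure_limit:
  assumes "\<And>n::nat. f n \<in> sine_closure" "f \<longlonglongrightarrow> l"
  shows "l \<in> sine_closure"
  using assms closed_sequentially[of sine_closure f l] by (auto simp: sine_closure_def)

text \<open>
  The function \<open>cos (\<pi> x)\<close> maps \<open>[0,1]\<close> homeomorphically onto \<open>[-1,1]\<close>, so by Weierstrass' theorem
  \<open>h\<close> is a uniform limit of polynomials in \<open>cos (\<pi> x)\<close>.
\<close>

lemma sine_times_continuous_in_closure:
  assumes h: "continuous_on {0..1} h"
  shows "abs_L2 (\<lambda>x. sine 1 x * h x) \<in> sine_closure"
proof -
  define H where "H y = h (arccos y / pi)" for y
  have "continuous_on {-1..1} H"
    unfolding H_def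
    by (intro continuous_on_compose2[OF h] continuous_intros) (auto simp: arccos_lbound arccos_ubound)
  then have "\<exists>p. real_polynomial_function p \<and> (\<forall>y\<in>{-1..1}. \<bar>H y - p y\<bar> < 1 / real (Suc n))" for n
  proof -
    have "compact {-1..1::real}" "0 < 1 / real (Suc n)" by simp_all
    from Stone_Weierstrass_real_polynomial_function[OF this(1) \<open>continuous_on {-1..1} H\<close> this(2)]
    obtain p where "real_polynomial_function p" "\<And>y. y \<in> {-1..1} \<Longrightarrow> \<bar>H y - p y\<bar> < 1 / real (Suc n)"
      by blast
    then show ?thesis by blast
  qed
  then obtain p where p: "\<And>n. real_polynomial_function (p n)"
      "\<And>n y. y \<in> {-1..1} \<Longrightarrow> \<bar>H y - p n y\<bar> < 1 / real (Suc n)" by metis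
  have close: "\<bar>h x - p n (cos (pi * x))\<bar> < 1 / real (Suc n)" if "x \<in> {0..1}" for n x
    using p(2)[of "cos (pi * x)" n] that by (simp add: H_def arccos_cos mult_le_cancel_left1)
  show ?thesis
  proof (rule sine_closure_limit)
    show "abs_L2 (\<lambda>x. sine 1 x * p n (cos (pi * x))) \<in> sine_closure" for n
    proof -
      obtain a N where a: "p n = (\<lambda>y. \<Sum>i\<le>N. a i * y ^ i)"
        using p(1)[of n] unfolding real_polynomial_function_iff_sum by blast
      have "(\<lambda>x. sine 1 x * p n (cos (pi * x))) = (\<lambda>x. \<Sum>i\<le>N. a i * (sine 1 x * cos (pi * x) ^ i))"
        by (simp add: a sum_distrib_left mult_ac)
      then have "abs_L2 (\<lambda>x. sine 1 x * p n (cos (pi * x))) =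
          (\<Sum>i\<le>N. a i *\<^sub>R abs_L2 (\<lambda>x. sine 1 x * cos (pi * x) ^ i))"
        by (simp only: abs_L2_sum abs_L2_scale square_integrable_scale square_integrable_sine_cos_power)
      also have "\<dots> \<in> span (range (\<lambda>k. abs_L2 (sine k)))"
        by (intro span_sum span_scale sine_cos_power_in_span)
      finally show ?thesis using closure_subset by (auto simp: sine_closure_def)
    qed
    show "(\<lambda>n. abs_L2 (\<lambda>x. sine 1 x * p n (cos (pi * x)))) \<longlonglongrightarrow> abs_L2 (\<lambda>x. sine 1 x * h x)"
    proof (rule L2_dominated_convergence)
      show "square_integrable (\<lambda>x. \<bar>h x\<bar> + 1)"
        using h by (intro square_integrable_continuous continuous_intros)
      have p_cont: "continuous_on UNIV (p n)" for n
        using p(1) by (simp add: continuous_real_polymonial_function continuous_at_imp_continuous_on)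
      have "continuous_on {0..1} (\<lambda>x. p n (cos (pi * x)))" for n
        by (rule continuous_on_compose2[OF p_cont]) (auto intro!: continuous_intros)
      then have "continuous_on {0..1} (\<lambda>x. sine 1 x * p n (cos (pi * x)))" for n
        unfolding sine_def by (rule continuous_on_mult[rotated]) (intro continuous_intros)
      then show "(\<lambda>x. sine 1 x * p n (cos (pi * x))) \<in> borel_measurable unit_leb" for n
        by (rule measurable_continuous_unit_leb)
      have "continuous_on {0..1} (\<lambda>x. sine 1 x * h x)"
        using h unfolding sine_def by (intro continuous_intros)
      then show "(\<lambda>x. sine 1 x * h x) \<in> borel_measurable unit_leb"
        by (rule measurable_continuous_unit_leb)
      show "AE x in unit_leb. \<bar>sine 1 x * p n (cos (pi * x))\<bar> \<le> \<bar>h x\<bar> + 1" for n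
        using AE_unit_leb_interior
      proof eventually_elim
        case (elim x)
        have "1 / real (Suc n) \<le> 1" by simp
        then have "\<bar>p n (cos (pi * x))\<bar> \<le> \<bar>h x\<bar> + 1" using close[of x n] elim
            by (simp only: atLeastAtMost_iff) linarith
        moreover have "\<bar>sine 1 x\<bar> \<le> 1" by (simp add: sine_def)
        ultimately show ?case
          using mult_mono[of "\<bar>sine 1 x\<bar>" 1 "\<bar>p n (cos (pi * x))\<bar>" "\<bar>h x\<bar> + 1"]
          by (simp add: abs_mult)
      qed
      show "AE x in unit_leb. (\<lambda>n. sine 1 x * p n (cos (pi * x))) \<longlonglongrightarrow> sine 1 x * h x"
        using AE_unit_leb_interior
      proof eventually_elim
        case (elim x)
        have "(\<lambda>n. h x - p n (cos (pi * x))) \<longlonglongrightarrow> 0"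
          by (rule Lim_null_comparison[OF _ lim_1_over_n[THEN LIMSEQ_Suc]])
             (use close[of x] elim in \<open>auto intro!: always_eventually less_imp_le\<close>)
        from tendsto_diff[OF tendsto_const[of "h x"] this] show ?case
          by (intro tendsto_intros) simp
      qed
    qed
  qed
qed

text \<open>
  Dividing \<open>g\<close> by \<open>sin (\<pi> x)\<close> may destroy continuity at the end points. The factor
  \<open>sin\<^sup>2 / (sin\<^sup>2 + 1/n)\<close> repairs this and tends to \<open>1\<close> inside the interval.
\<close>

lemma continuous_in_sine_closure:
  assumes g: "continuous_on {0..1} g"
  shows "abs_L2 g \<in> sine_closure"
proof (rule sine_closure_limit)
  let ?h = "\<lambda>n x. sine 1 x * g x / ((sine 1 x)\<^sup>2 + 1 / real (Suc n))"
  have pos: "0 < y\<^sup>2 + 1 / real (Suc n)" for y :: real and n by (simp add: add_nonneg_pos)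
  have h: "continuous_on {0..1} (?h n)" for n
    using g pos unfolding sine_def by (intro continuous_intros) (auto simp: less_imp_neq[symmetric])
  show "abs_L2 (\<lambda>x. sine 1 x * ?h n x) \<in> sine_closure" for n
      by (rule sine_times_continuous_in_closure[OF h])
  show "(\<lambda>n. abs_L2 (\<lambda>x. sine 1 x * ?h n x)) \<longlonglongrightarrow> abs_L2 g"
  proof (rule L2_dominated_convergence)
    show "square_integrable (\<lambda>x. \<bar>g x\<bar>)" "g \<in> borel_measurable unit_leb"
      using square_integrable_continuous[OF g] by (auto simp: square_integrable_def)
    have "continuous_on {0..1} (\<lambda>x. sine 1 x * ?h n x)" for n
      unfolding sine_def by (intro continuous_on_mult[OF _ h[unfolded sine_def]] continuous_intros)
    then show "(\<lambda>x. sine 1 x * ?h n x) \<in> borel_measurable unit_leb" for n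
      by (rule measurable_continuous_unit_leb)
    have "\<bar>y * (y * c / (y\<^sup>2 + 1 / real (Suc n)))\<bar> \<le> \<bar>c\<bar>" for y c :: real and n
    proof -
      have "\<bar>y * (y * c / (y\<^sup>2 + 1 / real (Suc n)))\<bar> = \<bar>c\<bar> * (y\<^sup>2 / (y\<^sup>2 + 1 / real (Suc n)))"
        using pos[of y n] by (simp add: abs_mult power2_eq_square)
      also have "\<dots> \<le> \<bar>c\<bar> * 1"
        using pos[of y n] by (intro mult_left_mono) auto
      finally show ?thesis by simp
    qed
    then show "AE x in unit_leb. \<bar>sine 1 x * ?h n x\<bar> \<le> \<bar>g x\<bar>" for n by simp
    show "AE x in unit_leb. (\<lambda>n. sine 1 x * ?h n x) \<longlonglongrightarrow> g x"
      using AE_unit_leb_interior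
    proof eventually_elim
      case (elim x)
      then have "sine 1 x > 0" by (simp add: sine_def sin_gt_zero)
      then have "(\<lambda>n. sine 1 x * ?h n x) \<longlonglongrightarrow> sine 1 x * (sine 1 x * g x / ((sine 1 x)\<^sup>2 + 0))"
        by (intro tendsto_intros lim_1_over_n[THEN LIMSEQ_Suc]) auto
      then show ?case using \<open>sine 1 x > 0\<close> by (simp add: power2_eq_square)
    qed
  qed
qed

lemma clamp_abs_le: "\<bar>max (- B) (min B y)\<bar> \<le> B" if "0 \<le> B" for B y :: real
  using that by auto

text \<open>
  A measurable function is the limit almost everywhere of continuous ones; clamping these to
  \<open>[-B, B]\<close> provides the majorant.
\<close>

lemma bounded_in_sine_closure:
  assumes f: "f \<in> borel_measurable unit_leb" "\<And>x. \<bar>f x\<bar> \<le> B"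
  shows "abs_L2 f \<in> sine_closure"
proof -
  have B: "0 \<le> B" using f(2)[of 0] by simp
  have "f measurable_on {0..1}" using f by (simp add: measurable_on_iff_borel_measurable)
  then obtain N g where N: "negligible N" and g: "\<And>n. continuous_on UNIV (g n)"
      "\<And>x. x \<notin> N \<Longrightarrow> (\<lambda>n. g n x) \<longlonglongrightarrow> (if x \<in> {0..1} then f x else 0)"
    by (auto simp: measurable_on_def)
  show ?thesis
  proof (rule sine_closure_limit)
    have c: "continuous_on {0..1} (\<lambda>x. max (- B) (min B (g n x)))" for n
      by (intro continuous_intros continuous_on_subset[OF g(1)]) auto
    then show "abs_L2 (\<lambda>x. max (- B) (min B (g n x))) \<in> sine_closure" for n
        by (rule continuous_in_sine_closure)
    show "(\<lambda>n. abs_L2 (\<lambda>x. max (- B) (min B (g n x)))) \<longlonglongrightarrow> abs_L2 f"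
    proof (rule L2_dominated_convergence)
      show "square_integrable (\<lambda>x. B)" by (intro square_integrable_continuous continuous_intros)
      show "(\<lambda>x. max (- B) (min B (g n x))) \<in> borel_measurable unit_leb" for n
        by (rule measurable_continuous_unit_leb[OF c])
      show "AE x in unit_leb. \<bar>max (- B) (min B (g n x))\<bar> \<le> B" for n by (simp add: clamp_abs_le B)
      have "AE x in lebesgue. x \<notin> N"
        by (intro AE_not_in) (use N in \<open>simp add: negligible_iff_null_sets\<close>)
      then show "AE x in unit_leb. (\<lambda>n. max (- B) (min B (g n x))) \<longlonglongrightarrow> f x"
      proof (simp add: AE_restrict_space_iff, eventually_elim, safe)
        fix x :: real assume x: "x \<notin> N" "0 \<le> x" "x \<le> 1"
        then have "(\<lambda>n. max (- B) (min B (g n x))) \<longlonglongrightarrow> max (- B) (min B (f x))"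
          using g(2)[of x] by (intro tendsto_intros) auto
        moreover have "max (- B) (min B (f x)) = f x" using f(2)[of x] by auto
        ultimately show "(\<lambda>n. max (- B) (min B (g n x))) \<longlonglongrightarrow> f x" by simp
      qed
    qed (rule f)
  qed
qed

lemma in_sine_closure: "z \<in> sine_closure"
proof -
  obtain f where f: "square_integrable f" "z = abs_L2 f" by (rule L2_abs_cases)
  then have f_meas [measurable]: "f \<in> borel_measurable unit_leb" by (simp add: square_integrable_def)
  show ?thesis
    unfolding f(2)
  proof (rule sine_closure_limit)
    show "abs_L2 (\<lambda>x. max (- real n) (min (real n) (f x))) \<in> sine_closure" for n
      by (rule bounded_in_sine_closure[of _ "real n"]) (auto simp: clamp_abs_le)
    show "(\<lambda>n. abs_L2 (\<lambda>x. max (- real n) (min (real n) (f x)))) \<longlonglongrightarrow> abs_L2 f"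
    proof (rule L2_dominated_convergence)
      show "square_integrable (\<lambda>x. \<bar>f x\<bar>)" using f by (auto simp: square_integrable_def)
      show "AE x in unit_leb. (\<lambda>n. max (- real n) (min (real n) (f x))) \<longlonglongrightarrow> f x"
      proof (rule AE_I2)
        fix x
        obtain m where m: "\<bar>f x\<bar> \<le> real m" using real_arch_simple by blast
        have "\<forall>\<^sub>F n in sequentially. max (- real n) (min (real n) (f x)) = f x"
          using m by (intro eventually_sequentiallyI[of m]) auto
        then show "(\<lambda>n. max (- real n) (min (real n) (f x))) \<longlonglongrightarrow> f x"
          by (rule tendsto_eventually)
      qed
    qed auto
  qed
qed

lemma sines_dense: "closure (span (range (\<lambda>k. abs_L2 (sine k)))) = UNIV"
  using in_sine_closure by (auto simp: sine_closure_def)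

section \<open>Eigenvectors of the generator of a semigroup\<close>

text \<open>
  The Banach-Steinhaus theorem for sequences: by Baire's theorem one of the closed sets on which
  all \<open>T n\<close> are bounded by \<open>m\<close> contains a ball.
\<close>

lemma uniform_boundedness:
  fixes T :: "nat \<Rightarrow> 'a::banach \<Rightarrow> 'b::real_normed_vector"
  assumes lin: "\<And>n. bounded_linear (T n)"
    and bdd: "\<And>x. Bseq (\<lambda>n. T n x)"
  obtains M where "0 < M" "\<And>n x. norm (T n x) \<le> M * norm x"
proof -
  define F where "F m = {x. \<forall>n. norm (T n x) \<le> real m}" for m
  have closed_F: "closed (F m)" for m
  proof -
    have "F m = (\<Inter>n. {x. norm (T n x) \<le> real m})" by (auto simp: F_def)
    moreover have "closed {x. norm (T n x) \<le> real m}" for n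
      by (intro closed_Collect_le continuous_intros bounded_linear.continuous_on[OF lin])
    ultimately show ?thesis by auto
  qed
  have cover: "(\<Union>m. F m) = UNIV"
  proof -
    have "\<exists>m. x \<in> F m" for x
    proof -
      from bdd[of x] obtain K where "\<And>n. norm (T n x) \<le> K" by (auto simp: Bseq_def)
      moreover obtain m where "K \<le> real m" using real_arch_simple by blast
      ultimately have "x \<in> F m" by (auto simp: F_def intro: order_trans)
      then show ?thesis ..
    qed
    then show ?thesis by auto
  qed
  have "\<exists>m. interior (F m) \<noteq> {}"
  proof (rule ccontr)
    assume "\<not> ?thesis"
    then have empty: "interior (F m) = {}" for m by simp
    have "euclidean interior_of \<Union>(range F) = {}"
      by (rule Baire_category_alt)
         (auto simp: completely_metrizable_space_euclidean empty closed_F)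
    then show False using cover by simp
  qed
  then obtain m x where "x \<in> interior (F m)" by auto
  then obtain r where r: "0 < r" "cball x r \<subseteq> F m"
    by (meson mem_interior_cball)
  have bound: "norm (T n y) \<le> (2 * real m / r) * norm y" for n y
  proof (cases "y = 0")
    case True
    interpret bounded_linear "T n" by (rule lin)
    from True show ?thesis by (simp add: zero)
  next
    case False
    interpret bounded_linear "T n" by (rule lin)
    \<comment> \<open>Scale \<open>y\<close> to length \<open>r\<close>, so that both \<open>x\<close> and \<open>x + ?u\<close> lie in the ball.\<close>
    let ?u = "(r / norm y) *\<^sub>R y"
    have u: "norm ?u = r" using False r by simp
    have "x + ?u \<in> F m" "x \<in> F m" using r u by (auto intro!: subsetD[OF r(2)] simp: dist_norm)
    then have "norm (T n (x + ?u)) \<le> real m" "norm (T n x) \<le> real m" by (auto simp: F_def)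
    moreover have "norm (T n ?u) \<le> norm (T n (x + ?u)) + norm (T n x)"
      using norm_triangle_ineq4[of "T n (x + ?u)" "T n x"] by (simp add: add)
    ultimately have "norm (T n ?u) \<le> 2 * real m" by linarith
    moreover have "norm (T n ?u) = r / norm y * norm (T n y)"
      using r by (simp add: scaleR)
    ultimately show ?thesis using False r by (simp add: field_simps)
  qed
  show ?thesis
  proof (rule that[of "2 * real m / r + 1"])
    show "0 < 2 * real m / r + 1" using r by (simp add: add_nonneg_pos)
    show "norm (T n y) \<le> (2 * real m / r + 1) * norm y" for n y
      using bound[of n y] by (simp add: distrib_right add_increasing2)
  qed
qed

text \<open>
  Otherwise there are times \<open>s N \<rightarrow> 0\<close> along which the operator norms are unbounded, although all
  orbits converge along them; this contradicts uniform boundedness.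
\<close>

lemma C0_semigroup_bounded_near_0:
  fixes S :: "real \<Rightarrow> 'a::banach \<Rightarrow> 'a"
  assumes "C0_semigroup S"
  obtains \<delta> M where "0 < \<delta>" "0 < M" "\<And>s x. 0 \<le> s \<Longrightarrow> s \<le> \<delta> \<Longrightarrow> norm (S s x) \<le> M * norm x"
proof -
  have lin: "bounded_linear (S t)" if "0 \<le> t" for t
    using assms that by (auto simp: C0_semigroup_def)
  have "\<exists>N. \<forall>s x. 0 \<le> s \<longrightarrow> s \<le> 1 / real (Suc N) \<longrightarrow> norm (S s x) \<le> real (Suc N) * norm x"
  proof (rule ccontr)
    assume "\<not> ?thesis"
    then have "\<forall>N. \<exists>s. 0 \<le> s \<and> s \<le> 1 / real (Suc N) \<and> (\<exists>x. norm (S s x) > real (Suc N) * norm x)"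
      by (meson not_le)
    then obtain s where s: "\<And>N. 0 \<le> s N" "\<And>N. s N \<le> 1 / real (Suc N)"
        "\<And>N. \<exists>x. norm (S (s N) x) > real (Suc N) * norm x"
      by metis
    have s0: "s \<longlonglongrightarrow> 0"
      by (rule tendsto_sandwich[OF _ _ tendsto_const lim_1_over_n[THEN LIMSEQ_Suc]])
         (use s in auto)
    have "Bseq (\<lambda>N. S (s N) x)" for x
    proof -
      have "((\<lambda>t. S t x) \<longlongrightarrow> S 0 x) (at 0 within {0..})"
        using assms by (auto simp: C0_semigroup_def at_within_Ici_at_right)
      then have "continuous (at 0 within {0..}) (\<lambda>t. S t x)"
        by (simp add: continuous_within)
      then have "(\<lambda>N. S (s N) x) \<longlonglongrightarrow> S 0 x"
        using s s0 by (auto simp: continuous_within_sequentially o_def)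
      then show ?thesis by (rule convergent_imp_Bseq[OF convergentI])
    qed
    then obtain M where M: "0 < M" "\<And>N x. norm (S (s N) x) \<le> M * norm x"
      using uniform_boundedness[of "\<lambda>N. S (s N)"] lin s(1) by blast
    obtain N where "M \<le> real N" using real_arch_simple by blast
    with s(3)[of N] obtain x where "real (Suc N) * norm x < norm (S (s N) x)" by auto
    also have "\<dots> \<le> M * norm x" by (rule M)
    also have "\<dots> \<le> real (Suc N) * norm x"
      using \<open>M \<le> real N\<close> by (intro mult_right_mono) auto
    finally show False by simp
  qed
  then show ?thesis using that[of "1 / real (Suc N)" "real (Suc N)" for N] by auto
qed

text \<open>
  The defect \<open>d(s) = S(s) z - exp (c s) z\<close> is \<open>o(s)\<close> at \<open>0\<close>. It satisfies
  \<open>d((j + 1) h) = S(j h) d(h) + exp (c h) d(j h)\<close>, so \<open>\<parallel>d(s)\<parallel>\<close> is at most a constant times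
  \<open>n \<parallel>d(s / n)\<parallel>\<close> for every \<open>n\<close>, which tends to \<open>0\<close>. Unlike an argument with right derivatives,
  this requires no continuity of the orbit from the left.
\<close>

lemma C0_semigroup_eigenvector:
  assumes S: "C0_semigroup S" and gen: "(z, c *\<^sub>R z) \<in> generator S" and t: "0 \<le> t"
  shows "S t z = exp (c * t) *\<^sub>R z"
proof -
  have lin: "bounded_linear (S t)" if "0 \<le> t" for t
    using S that by (auto simp: C0_semigroup_def)
  have S0: "S 0 = id" using S by (simp add: C0_semigroup_def)
  have S_add: "S (s + r) x = S s (S r x)" if "0 \<le> s" "0 \<le> r" for s r x
    using S that by (simp add: C0_semigroup_def)
  obtain \<delta> M where \<delta>: "0 < \<delta>" "0 < M" "\<And>s x. 0 \<le> s \<Longrightarrow> s \<le> \<delta> \<Longrightarrow> norm (S s x) \<le> M * norm x"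
    using C0_semigroup_bounded_near_0[OF S] by metis
  define d where "d s = S s z - exp (c * s) *\<^sub>R z" for s
  have d_lim: "((\<lambda>h. norm (d h) / h) \<longlongrightarrow> 0) (at_right 0)"
  proof -
    have 1: "((\<lambda>h. (S h z - z) /\<^sub>R h) \<longlongrightarrow> c *\<^sub>R z) (at_right 0)"
      using gen by (simp add: generator_def)
    have "((\<lambda>h. exp (c * h)) has_real_derivative c) (at 0)"
      by (auto intro!: derivative_eq_intros)
    then have "((\<lambda>h. (exp (c * h) - 1) / h) \<longlongrightarrow> c) (at_right 0)"
      by (auto simp: has_field_derivative_iff intro: tendsto_mono[OF at_within_le_at])
    from tendsto_norm[OF tendsto_diff[OF 1 tendsto_scaleR[OF this tendsto_const[of z]]]]
    have "((\<lambda>h. norm ((S h z - z) /\<^sub>R h - ((exp (c * h) - 1) / h) *\<^sub>R z)) \<longlongrightarrow> 0) (at_right 0)"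
      by simp
    then show ?thesis
    proof (rule filterlim_mono_eventually)
      show "\<forall>\<^sub>F h in at_right 0. norm ((S h z - z) /\<^sub>R h - ((exp (c * h) - 1) / h) *\<^sub>R z)
          = norm (d h) / h"
        using eventually_at_right_less[of "0::real"]
      proof eventually_elim
        case (elim h)
        have "(S h z - z) /\<^sub>R h - ((exp (c * h) - 1) / h) *\<^sub>R z = d h /\<^sub>R h"
          by (simp add: d_def algebra_simps divide_inverse)
        with elim show ?case by (simp add: divide_inverse mult.commute)
      qed
    qed auto
  qed
  have small: "d s = 0" if s: "0 < s" "s \<le> \<delta>" for s
  proof -
    have step: "norm (d (real j * h)) \<le> real j * (M * exp (\<bar>c\<bar> * (real j * h)) * norm (d h))"
      if h: "0 \<le> h" "real n * h = s" "j \<le> n" for n j h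
      using \<open>j \<le> n\<close>
    proof (induction j)
      case 0
      show ?case by (simp add: d_def S0)
    next
      case (Suc j)
      define b where "b = exp (\<bar>c\<bar> * h)"
      define B where "B = exp (\<bar>c\<bar> * (real j * h))"
      have jh: "0 \<le> real j * h" "real j * h \<le> s"
        using h Suc.prems by (auto intro!: mult_right_mono simp flip: h(2))
      interpret bounded_linear "S (real j * h)" by (rule lin[OF jh(1)])
      have b: "1 \<le> b * B" "exp (c * h) \<le> b" "0 \<le> b"
        using h jh by (auto simp: b_def B_def mult_right_mono simp flip: exp_add)
      have "S (real (Suc j) * h) z = S (real j * h) (S h z)"
        using S_add[OF jh(1) h(1), of z] by (simp add: algebra_simps)
      moreover have "exp (c * (real (Suc j) * h)) = exp (c * h) * exp (c * (real j * h))"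
        by (simp add: algebra_simps flip: exp_add)
      ultimately have "d (real (Suc j) * h) = S (real j * h) (d h) + exp (c * h) *\<^sub>R d (real j * h)"
        by (simp add: d_def diff scaleR scaleR_diff_right)
      then have "norm (d (real (Suc j) * h))
          \<le> norm (S (real j * h) (d h)) + exp (c * h) * norm (d (real j * h))"
        using norm_triangle_ineq[of "S (real j * h) (d h)" "exp (c * h) *\<^sub>R d (real j * h)"] by simp
      also have "\<dots> \<le> M * norm (d h) + b * (real j * (M * B * norm (d h)))"
        using Suc jh s b unfolding B_def
        by (intro add_mono mult_mono \<delta>(3)) auto
      also have "\<dots> \<le> M * (b * B) * norm (d h) + b * (real j * (M * B * norm (d h)))"
        using mult_left_mono[OF b(1), of "M * norm (d h)"] \<delta>(2) by (simp add: mult_ac)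
      also have "\<dots> = real (Suc j) * (M * (b * B) * norm (d h))"
        by (simp add: algebra_simps)
      also have "b * B = exp (\<bar>c\<bar> * (real (Suc j) * h))"
        by (simp add: b_def B_def algebra_simps flip: exp_add)
      finally show ?case .
    qed
    have seq: "filterlim (\<lambda>n. s / real (Suc n)) (at_right 0) sequentially"
    proof -
      have "(\<lambda>n. s * (1 / real (Suc n))) \<longlonglongrightarrow> s * 0"
        by (intro tendsto_intros lim_1_over_n[THEN LIMSEQ_Suc])
      then show ?thesis using s by (auto simp: filterlim_at)
    qed
    have "(\<lambda>n. M * exp (\<bar>c\<bar> * s) * s * (norm (d (s / real (Suc n))) / (s / real (Suc n)))) \<longlonglongrightarrow>
        M * exp (\<bar>c\<bar> * s) * s * 0"
      by (intro tendsto_intros filterlim_compose[OF d_lim seq])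
    moreover have "norm (d s) \<le> M * exp (\<bar>c\<bar> * s) * s * (norm (d (s / real (Suc n))) / (s / real
        (Suc n)))"
      for n
      using step[of "s / real (Suc n)" "Suc n" "Suc n"] s by (simp add: mult_ac)
    ultimately have "norm (d s) \<le> M * exp (\<bar>c\<bar> * s) * s * 0"
      by (intro LIMSEQ_le_const) auto
    then show ?thesis by simp
  qed
  \<comment> \<open>Arbitrary times are multiples of times in the interval where \<open>S\<close> is bounded.\<close>
  obtain m where m: "t / \<delta> \<le> real (Suc m)"
    using real_arch_simple[of "t / \<delta>"]
        by (metis less_imp_le of_nat_Suc order_trans le_add_same_cancel1 zero_le_one add.commute)
  define s where "s = t / real (Suc m)"
  have s: "0 \<le> s" "s \<le> \<delta>" "t = real (Suc m) * s"
    using m t \<delta>(1) by (auto simp: s_def field_simps)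
  have one: "S s z = exp (c * s) *\<^sub>R z"
    using small[of s] s by (cases "s = 0") (auto simp: d_def S0)
  have "S (real j * s) z = exp (c * (real j * s)) *\<^sub>R z" for j
  proof (induction j)
    case 0
    show ?case by (simp add: S0)
  next
    case (Suc j)
    interpret bounded_linear "S s" by (rule lin[OF s(1)])
    have "S (real (Suc j) * s) z = S s (S (real j * s) z)"
      using S_add[OF s(1), of "real j * s" z] s(1) by (simp add: algebra_simps)
    also have "\<dots> = (exp (c * (real j * s)) * exp (c * s)) *\<^sub>R z"
      by (simp add: Suc scaleR one)
    also have "exp (c * (real j * s)) * exp (c * s) = exp (c * (real (Suc j) * s))"
      by (simp add: algebra_simps flip: exp_add)
    finally show ?case .
  qed
  then show ?thesis using s(3) by metis
qed

section \<open>Smooth cutoffs of the sines\<close>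

lemma poly_times_exp_minus_at_top: "((\<lambda>y::real. poly p y * exp (- y)) \<longlongrightarrow> 0) at_top"
proof -
  have "((\<lambda>y. \<Sum>i\<le>degree p. coeff p i * (y ^ i / exp y)) \<longlongrightarrow> 0) at_top"
    by (intro tendsto_null_sum tendsto_mult_right_zero tendsto_power_div_exp_0)
  then show ?thesis by (simp add: poly_altdef exp_minus divide_inverse sum_distrib_right mult.assoc)
qed

text \<open>
  The classical smooth function \<open>exp (- 1 / x)\<close>, which is flat at \<open>0\<close>. With a polynomial in \<open>1 / x\<close>
  as a factor it becomes a family that is closed under differentiation.
\<close>

definition flat :: "real poly \<Rightarrow> real \<Rightarrow> real" where
  "flat p x = (if 0 < x then poly p (1 / x) * exp (- (1 / x)) else 0)"

lemma flat_tendsto_at_right: "(flat p \<longlongrightarrow> 0) (at_right 0)"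
proof -
  have "filterlim (\<lambda>x::real. 1 / x) at_top (at_right 0)"
    using filterlim_inverse_at_top_right by (simp add: inverse_eq_divide)
  from filterlim_compose[OF poly_times_exp_minus_at_top this]
  have "((\<lambda>x. poly p (1 / x) * exp (- (1 / x))) \<longlongrightarrow> 0) (at_right 0)" .
  then show ?thesis
    by (rule Lim_transform_eventually)
       (use eventually_at_right_less[of "0::real"] in \<open>eventually_elim, simp add: flat_def\<close>)
qed

lemma has_real_derivative_flat:
  "(flat p has_real_derivative flat ([:0, 0, 1:] * (p - pderiv p)) x) (at x)"
proof (cases x "0::real" rule: linorder_cases)
  case less
  have "((\<lambda>x. 0) has_real_derivative flat ([:0, 0, 1:] * (p - pderiv p)) x) (at x)"
    using less by (simp add: flat_def)
  then show ?thesis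
    by (rule has_field_derivative_transform_within_open[where S = "{..<0}"])
       (use less in \<open>auto simp: flat_def\<close>)
next
  case greater
  have "((\<lambda>x. poly p (1 / x) * exp (- (1 / x))) has_real_derivative
      flat ([:0, 0, 1:] * (p - pderiv p)) x) (at x)"
    using greater
    by (auto intro!: derivative_eq_intros DERIV_chain'[OF _ poly_DERIV]
        simp: flat_def field_simps power2_eq_square)
  then show ?thesis
    by (rule has_field_derivative_transform_within_open[where S = "{0<..}"])
       (use greater in \<open>auto simp: flat_def\<close>)
next
  case equal
  have "((\<lambda>h. flat p h / h) \<longlongrightarrow> 0) (at 0)"
  proof (rule filterlim_split_at)
    show "((\<lambda>h. flat p h / h) \<longlongrightarrow> 0) (at_left 0)"
      by (rule tendsto_eventually)
         (use eventually_at_left_real[of "-1" 0] in \<open>auto simp: flat_def elim!: eventually_mono\<close>)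
    show "((\<lambda>h. flat p h / h) \<longlongrightarrow> 0) (at_right 0)"
      by (rule Lim_transform_eventually[OF flat_tendsto_at_right[of "pCons 0 p"]])
         (use eventually_at_right_less[of "0::real"] in \<open>eventually_elim, simp add: flat_def\<close>)
  qed
  then show ?thesis using equal by (simp add: has_field_derivative_iff flat_def)
qed

lemma flat_tendsto_at_top: "(flat p \<longlongrightarrow> coeff p 0) at_top"
proof -
  have inv: "((\<lambda>x::real. 1 / x) \<longlongrightarrow> 0) at_top"
    using tendsto_inverse_0_at_top[OF filterlim_ident] by (simp add: inverse_eq_divide)
  have "((\<lambda>x. poly p (1 / x) * exp (- (1 / x))) \<longlongrightarrow> poly p 0 * exp (- 0)) at_top"
    by (intro tendsto_intros inv)
  then have "((\<lambda>x. poly p (1 / x) * exp (- (1 / x))) \<longlongrightarrow> coeff p 0) at_top"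
    by (simp add: poly_0_coeff_0)
  then show ?thesis
    by (rule Lim_transform_eventually)
       (use eventually_gt_at_top[of "0::real"] in \<open>eventually_elim, simp add: flat_def\<close>)
qed

lemma flat_1_bounds: "0 \<le> flat 1 x" "flat 1 x \<le> 1"
  by (auto simp: flat_def)

lemma flat_quadratic_le: "flat [:0, 1, 1:] x \<le> 3"
proof -
  have "s * exp (- s) + s\<^sup>2 * exp (- s) \<le> 3" if "0 \<le> s" for s :: real
  proof -
    have "1 + s + s\<^sup>2 / 2 \<le> exp s" using that by (rule exp_lower_Taylor_quadratic)
    then have "s + s\<^sup>2 \<le> 3 * exp s" using that by (smt (verit) field_sum_of_halves zero_le_power2)
    then show ?thesis by (simp add: exp_minus field_simps)
  qed
  then show ?thesis
    by (auto simp: flat_def algebra_simps power2_eq_square divide_inverse simp del: inverse_eq_divide)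
qed

text \<open>
  A class of differentiable functions that contains its own derivatives. Its members are therefore
  smooth, without any bookkeeping of iterated derivatives of products.
\<close>

inductive_set cutoff_algebra :: "(real \<Rightarrow> real) set" where
  const: "(\<lambda>x. c) \<in> cutoff_algebra"
| sin: "(\<lambda>x. sin (a * x)) \<in> cutoff_algebra"
| cos: "(\<lambda>x. cos (a * x)) \<in> cutoff_algebra"
| flat: "(\<lambda>x. flat p (a * x + b)) \<in> cutoff_algebra"
| add: "f \<in> cutoff_algebra \<Longrightarrow> g \<in> cutoff_algebra \<Longrightarrow> (\<lambda>x. f x + g x) \<in> cutoff_algebra"
| mult: "f \<in> cutoff_algebra \<Longrightarrow> g \<in> cutoff_algebra \<Longrightarrow> (\<lambda>x. f x * g x) \<in> cutoff_algebra"

lemma cutoff_algebra_derivative: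
  assumes "f \<in> cutoff_algebra"
  shows "\<exists>f'\<in>cutoff_algebra. \<forall>x. (f has_real_derivative f' x) (at x)"
  using assms
proof induction
  case (const c)
  show ?case by (rule bexI[OF _ cutoff_algebra.const[of 0]]) simp
next
  case (sin a)
  show ?case
    by (rule bexI[OF _ cutoff_algebra.mult[OF cutoff_algebra.const[of a] cutoff_algebra.cos[of a]]])
       (auto intro!: derivative_eq_intros)
next
  case (cos a)
  show ?case
    by (rule bexI[OF _ cutoff_algebra.mult[OF cutoff_algebra.const[of "- a"] cutoff_algebra.sin[of a]]])
       (auto intro!: derivative_eq_intros)
next
  case (flat p a b)
  have "((\<lambda>x. flat p (a * x + b)) has_real_derivative
      flat ([:0, 0, 1:] * (p - pderiv p)) (a * x + b) * a) (at x)" for x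
    by (rule DERIV_chain2[OF has_real_derivative_flat]) (auto intro!: derivative_eq_intros)
  then show ?case
    by (intro bexI[OF _ cutoff_algebra.mult[OF
            cutoff_algebra.flat[of "[:0, 0, 1:] * (p - pderiv p)" a b] cutoff_algebra.const[of a]]] allI)
next
  case (add f g)
  then obtain f' g' where "f' \<in> cutoff_algebra" "g' \<in> cutoff_algebra"
      "\<And>x. (f has_real_derivative f' x) (at x)" "\<And>x. (g has_real_derivative g' x) (at x)" by blast
  then show ?case
    by (intro bexI[OF _ cutoff_algebra.add[of f' g']]) (auto intro!: derivative_intros)
next
  case (mult f g)
  then obtain f' g' where "f' \<in> cutoff_algebra" "g' \<in> cutoff_algebra"
      "\<And>x. (f has_real_derivative f' x) (at x)" "\<And>x. (g has_real_derivative g' x) (at x)" by blast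
  with mult show ?case
    by (intro bexI[OF _ cutoff_algebra.add[OF cutoff_algebra.mult[of f' g] cutoff_algebra.mult[of
        f g']]])
       (auto intro!: derivative_eq_intros)
qed

lemma cutoff_algebra_smooth:
  assumes "f \<in> cutoff_algebra"
  shows "(deriv ^^ k) f field_differentiable at x"
proof -
  have step: "deriv g \<in> cutoff_algebra" if g: "g \<in> cutoff_algebra" for g
  proof -
    obtain g' where "g' \<in> cutoff_algebra" "\<And>x. (g has_real_derivative g' x) (at x)"
      using cutoff_algebra_derivative[OF g] by blast
    moreover from this have "deriv g = g'" by (intro ext DERIV_imp_deriv)
    ultimately show ?thesis by simp
  qed
  have "(deriv ^^ k) f \<in> cutoff_algebra"
    by (induction k) (auto simp: assms step)
  from cutoff_algebra_derivative[OF this] show ?thesis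
    unfolding field_differentiable_def by blast
qed

text \<open>
  The two factors vanish for \<open>x \<le> 1/n\<close> and for \<open>1 - x \<le> 1/n\<close>; for fixed \<open>x\<close> they tend to \<open>1\<close>.
\<close>

definition cutoff_sine :: "nat \<Rightarrow> nat \<Rightarrow> real \<Rightarrow> real" where
  "cutoff_sine k n x = sine k x * (flat 1 (real n * x - 1) * flat 1 (real n * (1 - x) - 1))"

lemma test_function_cutoff_sine: "test_function (cutoff_sine k n)"
proof -
  have "(\<lambda>x. sin ((real k * pi) * x) * (flat 1 (real n * x + (- 1)) * flat 1 ((- real n) * x
      + (real n - 1))))
      \<in> cutoff_algebra"
    by (intro cutoff_algebra.intros)
  also have "(\<lambda>x. sin ((real k * pi) * x) * (flat 1 (real n * x + (- 1)) * flat 1 ((- real n) * x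
      + (real n - 1))))
      = cutoff_sine k n"
    by (simp add: fun_eq_iff cutoff_sine_def sine_def algebra_simps)
  finally have "(deriv ^^ l) (cutoff_sine k n) field_differentiable at x" for l x
    by (rule cutoff_algebra_smooth)
  moreover have "closure {x. cutoff_sine k n x \<noteq> 0} \<subseteq> {x. 1 \<le> real n * x \<and> 1 \<le> real n * (1 - x)}"
    by (rule closure_minimal)
       (auto simp: cutoff_sine_def flat_def split: if_splits
         intro!: closed_Collect_conj closed_Collect_le continuous_intros)
  moreover have "\<dots> \<subseteq> {0<..<1}"
  proof
    fix x assume "x \<in> {x. 1 \<le> real n * x \<and> 1 \<le> real n * (1 - x)}"
    then have "0 < real n * x" "0 < real n * (1 - x)" by auto
    then show "x \<in> {0<..<1}" by (auto simp: zero_less_mult_iff)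
  qed
  ultimately show ?thesis by (auto simp: test_function_def)
qed

lemma has_real_derivative_sine:
  "(sine k has_real_derivative real k * pi * cos (real k * pi * x)) (at x)"
  unfolding sine_def[abs_def] by (auto intro!: derivative_eq_intros)

lemma deriv_cutoff_sine:
  "deriv (cutoff_sine k n) x =
     real k * pi * cos (real k * pi * x) * (flat 1 (real n * x - 1) * flat 1 (real n * (1 - x) - 1)) +
     (sine k x * real n * flat [:0, 0, 1:] (real n * x - 1)) * flat 1 (real n * (1 - x) - 1) -
     (sine k x * real n * flat [:0, 0, 1:] (real n * (1 - x) - 1)) * flat 1 (real n * x - 1)"
proof -
  have "[:0, 0, 1:] * (1 - pderiv 1) = ([:0, 0, 1:] :: real poly)" by (simp add: pderiv_1)
  note d = has_real_derivative_flat[of 1, unfolded this]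
  show ?thesis
    unfolding cutoff_sine_def[abs_def]
    by (rule DERIV_imp_deriv)
       (auto intro!: derivative_eq_intros has_real_derivative_sine DERIV_chain'[OF _ d] simp:
           algebra_simps)
qed

text \<open>
  With \<open>y = n x - 1\<close> this says that \<open>x\<close> times the derivative of the cutoff \<open>flat 1 (n x - 1)\<close> is a
  function of \<open>n x - 1\<close> alone. Since the sine is bounded by a multiple of \<open>x\<close>, the derivative of the
  cutoff is controlled after multiplication with the sine.
\<close>

lemma flat_shift: "(y + 1) * flat [:0, 0, 1:] y = flat [:0, 1, 1:] y"
  by (simp add: flat_def field_simps)

lemma abs_sine_le: "\<bar>sine k x\<bar> \<le> real k * pi * \<bar>x\<bar>" "\<bar>sine k x\<bar> \<le> real k * pi * \<bar>1 - x\<bar>"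
proof -
  show 1: "\<bar>sine k x\<bar> \<le> real k * pi * \<bar>x\<bar>" for x
    using abs_sin_x_le_abs_x[of "real k * pi * x"] by (simp add: sine_def abs_mult)
  have "\<bar>sine k (1 - x)\<bar> = \<bar>sine k x\<bar>"
    by (simp add: sine_def right_diff_distrib sin_diff abs_mult)
  with 1[of "1 - x"] show "\<bar>sine k x\<bar> \<le> real k * pi * \<bar>1 - x\<bar>" by simp
qed

lemma sine_ends: "sine k 0 = 0" "sine k 1 = 0"
  by (simp_all add: sine_def)

lemma flat_affine_tendsto:
  assumes "0 < x"
  shows "(\<lambda>n. flat p (real n * x - 1)) \<longlonglongrightarrow> coeff p 0"
proof (rule filterlim_compose[OF flat_tendsto_at_top])
  show "filterlim (\<lambda>n. real n * x - 1) at_top sequentially"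
    using assms by real_asymp
qed

lemma flat_layer_bound:
  assumes "0 \<le> x" "\<bar>s\<bar> \<le> real k * pi * x"
  shows "\<bar>s * real n * flat [:0, 0, 1:] (real n * x - 1)\<bar> \<le> real k * pi * 3"
proof -
  have nonneg: "0 \<le> flat [:0, 0, 1:] y" for y by (simp add: flat_def)
  have "\<bar>s * real n * flat [:0, 0, 1:] (real n * x - 1)\<bar> = \<bar>s\<bar> * (real n * flat [:0, 0, 1:] (real
      n * x - 1))"
    using nonneg by (simp add: abs_mult)
  also have "\<dots> \<le> (real k * pi * x) * (real n * flat [:0, 0, 1:] (real n * x - 1))"
    using assms nonneg by (intro mult_right_mono) auto
  also have "\<dots> = real k * pi * flat [:0, 1, 1:] (real n * x - 1)"
    using flat_shift[of "real n * x - 1"] by (simp add: mult_ac)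
  also have "\<dots> \<le> real k * pi * 3" by (intro mult_left_mono flat_quadratic_le) auto
  finally show ?thesis .
qed

lemma flat_layer_tendsto:
  assumes "0 < x"
  shows "(\<lambda>n. s * real n * flat [:0, 0, 1:] (real n * x - 1)) \<longlonglongrightarrow> 0"
proof -
  have "(\<lambda>n. s / x * flat [:0, 1, 1:] (real n * x - 1)) \<longlonglongrightarrow> s / x * coeff [:0, 1, 1:] 0"
    using assms by (intro tendsto_intros flat_affine_tendsto)
  moreover have "s / x * flat [:0, 1, 1:] (real n * x - 1) = s * real n * flat [:0, 0, 1:] (real
      n * x - 1)" for n
    using assms flat_shift[of "real n * x - 1"] by (simp add: field_simps)
  ultimately show ?thesis by simp
qed

lemma continuous_deriv_cutoff_sine: "continuous_on A ((deriv ^^ l) (cutoff_sine k n))"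
  using test_function_cutoff_sine[of k n]
  by (auto simp: test_function_def intro!: continuous_at_imp_continuous_on
      field_differentiable_imp_continuous_at)

lemma cutoff_sine_tendsto: "(\<lambda>n. abs_L2 (cutoff_sine k n)) \<longlonglongrightarrow> abs_L2 (sine k)"
proof (rule L2_dominated_convergence)
  show "square_integrable (\<lambda>x. 1)" by (intro square_integrable_continuous continuous_intros)
  show "cutoff_sine k n \<in> borel_measurable unit_leb" for n
    by (rule measurable_continuous_unit_leb) (use continuous_deriv_cutoff_sine[of _ 0] in simp)
  show "sine k \<in> borel_measurable unit_leb"
    unfolding sine_def[abs_def] by (intro measurable_continuous_unit_leb continuous_intros)
  show "AE x in unit_leb. \<bar>cutoff_sine k n x\<bar> \<le> 1" for n
  proof (rule AE_I2)
    fix x show "\<bar>cutoff_sine k n x\<bar> \<le> 1"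
      unfolding cutoff_sine_def abs_mult
      by (intro mult_le_one) (auto simp: sine_def flat_1_bounds)
  qed
  show "AE x in unit_leb. (\<lambda>n. cutoff_sine k n x) \<longlonglongrightarrow> sine k x"
    using AE_unit_leb_interior
  proof eventually_elim
    case (elim x)
    then have "(\<lambda>n. cutoff_sine k n x) \<longlonglongrightarrow> sine k x * (coeff 1 0 * coeff 1 0)"
      unfolding cutoff_sine_def by (intro tendsto_intros flat_affine_tendsto) auto
    then show ?case by simp
  qed
qed

text \<open>
  The first summand of the derivative gives the limit. The other two come from the cutoffs; they
  are bounded and tend to \<open>0\<close> pointwise.
\<close>

lemma deriv_cutoff_sine_tendsto:
  "(\<lambda>n. abs_L2 (deriv (cutoff_sine k n))) \<longlonglongrightarrow> abs_L2 (\<lambda>x. real k * pi * cos (real k * pi * x))"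
proof (rule L2_dominated_convergence)
  show "square_integrable (\<lambda>x. real k * pi + real k * pi * 3 + real k * pi * 3)"
    by (intro square_integrable_continuous continuous_intros)
  show "deriv (cutoff_sine k n) \<in> borel_measurable unit_leb" for n
    by (rule measurable_continuous_unit_leb) (use continuous_deriv_cutoff_sine[of _ 1] in simp)
  show "(\<lambda>x. real k * pi * cos (real k * pi * x)) \<in> borel_measurable unit_leb"
    by (intro measurable_continuous_unit_leb continuous_intros)
  show "AE x in unit_leb. \<bar>deriv (cutoff_sine k n) x\<bar> \<le> real k * pi + real k * pi * 3
      + real k * pi * 3" for n
    using AE_unit_leb_interior
  proof eventually_elim
    case (elim x)
    have shrink: "\<bar>a * b\<bar> \<le> c" if "\<bar>a\<bar> \<le> c" "0 \<le> b" "b \<le> 1" for a b c :: real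
      using mult_mono[of "\<bar>a\<bar>" c b 1] that by (simp add: abs_mult)
    have tri: "\<bar>a + b - c\<bar> \<le> A + B + C" if "\<bar>a\<bar> \<le> A" "\<bar>b\<bar> \<le> B" "\<bar>c\<bar> \<le> C" for a b c A B C :: real
      using that by linarith
    have bulk: "\<bar>real k * pi * cos (real k * pi * x)\<bar> \<le> real k * pi"
      using mult_left_mono[of "\<bar>cos (real k * pi * x)\<bar>" 1 "real k * pi"] by (simp add: abs_mult)
    have cutoff: "0 \<le> flat 1 y * flat 1 z" "flat 1 y * flat 1 z \<le> 1" for y z
      by (simp_all add: flat_1_bounds mult_le_one)
    have layers: "\<bar>sine k x * real n * flat [:0, 0, 1:] (real n * x - 1)\<bar> \<le> real k * pi * 3"
      "\<bar>sine k x * real n * flat [:0, 0, 1:] (real n * (1 - x) - 1)\<bar> \<le> real k * pi * 3"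
      using elim abs_sine_le[of k x] by (auto intro!: flat_layer_bound)
    show ?case
      unfolding deriv_cutoff_sine
      by (rule tri[OF shrink[OF bulk cutoff] shrink[OF layers(1) flat_1_bounds]
            shrink[OF layers(2) flat_1_bounds]])
  qed
  show "AE x in unit_leb. (\<lambda>n. deriv (cutoff_sine k n) x) \<longlonglongrightarrow> real k * pi * cos (real k * pi * x)"
    using AE_unit_leb_interior
  proof eventually_elim
    case (elim x)
    then have "(\<lambda>n. deriv (cutoff_sine k n) x) \<longlonglongrightarrow>
        real k * pi * cos (real k * pi * x) * (coeff 1 0 * coeff 1 0) + 0 * coeff 1 0 - 0 * coeff 1 0"
      unfolding deriv_cutoff_sine
      by (intro tendsto_add tendsto_diff tendsto_mult tendsto_const flat_affine_tendsto
          flat_layer_tendsto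
          tendsto_mult[OF flat_layer_tendsto flat_affine_tendsto]) auto
    then show ?case by simp
  qed
qed

section \<open>The sines are eigenvectors of the Dirichlet Laplacian\<close>

lemma integration_by_parts_unit_leb:
  fixes f g f' g' :: "real \<Rightarrow> real"
  assumes f: "\<And>x. (f has_real_derivative f' x) (at x)" "continuous_on {0..1} f'"
    and g: "\<And>x. (g has_real_derivative g' x) (at x)" "continuous_on {0..1} g'"
    and ends: "f 0 * g 0 = 0" "f 1 * g 1 = 0"
  shows "abs_L2 f \<bullet> abs_L2 g' = - (abs_L2 f' \<bullet> abs_L2 g)"
proof -
  have fg: "continuous_on {0..1} f" "continuous_on {0..1} g"
    using f(1) g(1) by (auto intro!: continuous_at_imp_continuous_on DERIV_isCont)
  note sq = square_integrable_continuous
  have int: "integrable unit_leb (\<lambda>x. f x * g' x)" "integrable unit_leb (\<lambda>x. f' x * g x)"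
    using f g fg by (auto intro!: square_integrable_mult sq)
  have "((\<lambda>x. f x * g x) has_vector_derivative f x * g' x + f' x * g x) (at x within {0..1})" for x
    using has_field_derivative_at_within[OF DERIV_mult'[OF f(1) g(1)]]
    by (simp add: has_real_derivative_iff_has_vector_derivative)
  then have "((\<lambda>x. f x * g' x + f' x * g x) has_integral (f 1 * g 1 - f 0 * g 0)) {0..1}"
    by (intro fundamental_theorem_of_calculus) simp_all
  then have "(LINT x|unit_leb. f x * g' x + f' x * g x) = 0"
    using int ends by (subst lebesgue_integral_eq_integral) (auto intro: integral_unique)
  then have "(LINT x|unit_leb. f x * g' x) + (LINT x|unit_leb. f' x * g x) = 0"
    using int by simp
  then show ?thesis using f(2) g(2) fg by (simp add: inner_abs_L2 sq)
qed

lemma test_function_derivatives: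
  assumes "test_function \<phi>"
  shows "((deriv ^^ k) \<phi> has_real_derivative (deriv ^^ Suc k) \<phi> x) (at x)"
    and "continuous_on A ((deriv ^^ k) \<phi>)"
  using assms
  by (auto simp: test_function_def DERIV_deriv_iff_field_differentiable intro!:
      continuous_at_imp_continuous_on
      field_differentiable_imp_continuous_at)

lemma test_function_ends:
  assumes "test_function \<phi>"
  shows "\<phi> 0 = 0" "\<phi> 1 = 0"
  using assms closure_subset[of "{x. \<phi> x \<noteq> 0}"] by (auto simp: test_function_def)

text \<open>
  For the second derivative, integrate by parts twice. The boundary terms vanish first because of the
  sine and then because of the test function.
\<close>

lemma weak_derivatives_sine:
  "weak_derivative 1 (abs_L2 (sine k)) (abs_L2 (\<lambda>x. real k * pi * cos (real k * pi * x)))"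
  "weak_derivative 2 (abs_L2 (sine k)) (- (real k * pi)\<^sup>2 *\<^sub>R abs_L2 (sine k))"
proof -
  let ?c = "\<lambda>x. real k * pi * cos (real k * pi * x)"
  have c: "continuous_on A ?c" for A by (intro continuous_intros)
  have s: "continuous_on A (sine k)" for A unfolding sine_def[abs_def] by (intro continuous_intros)
  have c': "(?c has_real_derivative - (real k * pi)\<^sup>2 * sine k x) (at x)" for x
    by (auto intro!: derivative_eq_intros simp: sine_def power2_eq_square)
  have first: "abs_L2 (sine k) \<bullet> abs_L2 (deriv g) = - (abs_L2 ?c \<bullet> abs_L2 g)"
    if "\<And>x. (g has_real_derivative deriv g x) (at x)" "continuous_on {0..1} (deriv g)" for g
    by (rule integration_by_parts_unit_leb) (use that c has_real_derivative_sine sine_ends in auto)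
  show "weak_derivative 1 (abs_L2 (sine k)) (abs_L2 ?c)"
    unfolding weak_derivative_def
  proof safe
    fix \<phi> assume \<phi>: "test_function \<phi>"
    show "abs_L2 (sine k) \<bullet> abs_L2 ((deriv ^^ 1) \<phi>) = (- 1) ^ 1 * (abs_L2 ?c \<bullet> abs_L2 \<phi>)"
      using first[of \<phi>] test_function_derivatives(1)[OF \<phi>, of 0] test_function_derivatives(2)[OF
          \<phi>, of _ 1]
      by simp
  qed
  show "weak_derivative 2 (abs_L2 (sine k)) (- (real k * pi)\<^sup>2 *\<^sub>R abs_L2 (sine k))"
    unfolding weak_derivative_def
  proof safe
    fix \<phi> assume \<phi>: "test_function \<phi>"
    have "abs_L2 (sine k) \<bullet> abs_L2 (deriv (deriv \<phi>)) = - (abs_L2 ?c \<bullet> abs_L2 (deriv \<phi>))"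
      using first[of "deriv \<phi>"] test_function_derivatives(1)[OF \<phi>, of 1]
          test_function_derivatives(2)[OF \<phi>, of _ 2]
      by (simp add: numeral_2_eq_2)
    also have "abs_L2 ?c \<bullet> abs_L2 (deriv \<phi>) = - (abs_L2 (\<lambda>x. - (real k * pi)\<^sup>2 * sine k x) \<bullet> abs_L2 \<phi>)"
      by (rule integration_by_parts_unit_leb[OF c'])
         (use s test_function_ends[OF \<phi>] test_function_derivatives(1)[OF \<phi>, of 0]
            test_function_derivatives(2)[OF \<phi>, of _ 1] in \<open>auto intro!: continuous_intros\<close>)
    also have "abs_L2 (\<lambda>x. - (real k * pi)\<^sup>2 * sine k x) = - (real k * pi)\<^sup>2 *\<^sub>R abs_L2 (sine k)"
      by (intro abs_L2_scale square_integrable_continuous s)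
    finally show "abs_L2 (sine k) \<bullet> abs_L2 ((deriv ^^ 2) \<phi>) =
        (- 1) ^ 2 * (- (real k * pi)\<^sup>2 *\<^sub>R abs_L2 (sine k) \<bullet> abs_L2 \<phi>)"
      by (simp add: numeral_2_eq_2)
  qed
qed

lemma sine_eigenvector_heat_operator:
  "(abs_L2 (sine k), (- \<alpha> * (real k * pi)\<^sup>2) *\<^sub>R abs_L2 (sine k)) \<in> heat_operator \<alpha>"
proof -
  let ?e = "abs_L2 (sine k)"
  have "\<exists>w. weak_derivative j ?e w" if "j \<le> 2" for j
  proof -
    have "j = 0 \<or> j = 1 \<or> j = 2" using that by linarith
    then consider "j = 0" | "j = 1" | "j = 2" by blast
    then show ?thesis
    proof cases
      case 1
      have "weak_derivative 0 ?e ?e" by (simp add: weak_derivative_def)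
      with 1 show ?thesis by blast
    qed (use weak_derivatives_sine in blast)+
  qed
  then have H: "?e \<in> sobolev_H 2" "?e \<in> sobolev_H 1" by (auto simp: sobolev_H_def)
  moreover have "?e \<in> sobolev_H10"
    unfolding sobolev_H10_def
    using H(2) weak_derivatives_sine(1) test_function_cutoff_sine cutoff_sine_tendsto
        deriv_cutoff_sine_tendsto
    by blast
  moreover have "(- \<alpha> * (real k * pi)\<^sup>2) *\<^sub>R ?e = \<alpha> *\<^sub>R (- (real k * pi)\<^sup>2 *\<^sub>R ?e)" by simp
  ultimately show ?thesis
    using weak_derivatives_sine(2)[of k] unfolding heat_operator_def by blast
qed

section \<open>Cells, cell averages and step functions\<close>

text \<open>
  The index runs through all nodes including the end points \<open>0\<close> and \<open>n + 1\<close>, so that the cells cover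
  \<open>[0,1]\<close>. Only the cells with \<open>1 \<le> m \<le> n\<close> carry grid values.
\<close>

definition cell :: "nat \<Rightarrow> nat \<Rightarrow> real set" where
  "cell n m = {node n m - mesh n / 2 ..< node n m + mesh n / 2}"

lemma mesh_pos: "0 < mesh n"
  by (simp add: mesh_def)

lemma node_ends: "node n 0 = 0" "node n (Suc n) = 1"
  by (simp_all add: node_def mesh_def)

lemma cell_unique:
  assumes "x \<in> cell n a" "x \<in> cell n b"
  shows "a = b"
proof -
  have "\<bar>real a - real b\<bar> * mesh n = \<bar>node n a - node n b\<bar>"
    using mesh_pos[of n] by (simp add: node_def abs_mult flip: left_diff_distrib)
  also have "\<dots> < 1 * mesh n"
    using assms by (auto simp: cell_def)
  finally have "\<bar>real a - real b\<bar> < 1" using mesh_pos[of n] by (simp only: mult_less_cancel_right_pos)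
  then show ?thesis by linarith
qed

lemma in_cell:
  assumes "0 \<le> x" "x \<le> 1"
  obtains m where "m \<le> Suc n" "x \<in> cell n m"
proof -
  \<comment> \<open>The index of the nearest node, rounding up at the midpoints as in the half-open cells.\<close>
  define m where "m = nat \<lfloor>x / mesh n + 1/2\<rfloor>"
  have "0 \<le> x / mesh n" using assms mesh_pos[of n] by simp
  then have m: "real m \<le> x / mesh n + 1/2" "x / mesh n + 1/2 < real m + 1"
    unfolding m_def by linarith+
  have "(real m - 1/2) * mesh n \<le> x" "x < (real m + 1/2) * mesh n"
    using m mesh_pos[of n] by (simp_all add: field_simps)
  then have cell: "x \<in> cell n m" by (simp add: cell_def node_def algebra_simps)
  have "x / mesh n \<le> 1 / mesh n" using assms mesh_pos[of n] by (simp add: divide_right_mono)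
  then have "x / mesh n \<le> real n + 1" by (simp add: mesh_def)
  with m have "real m \<le> real n + 1 + 1/2" by linarith
  then have "m \<le> Suc n" by linarith
  then show ?thesis using cell by (rule that)
qed

lemma grid_embed_eq: "grid_embed n v = abs_L2 (\<lambda>x. \<Sum>i<n. v $ i * indicator (cell n (Suc i)) x)"
  by (simp add: grid_embed.abs_eq cell_def)

lemma step_function_value:
  assumes "x \<in> cell n m"
  shows "(\<Sum>i<n. c i * indicator (cell n (Suc i)) x) = (if 1 \<le> m \<and> m \<le> n then c (m - 1) else (0::real))"
proof -
  have "indicator (cell n (Suc i)) x = (if Suc i = m then 1 else (0::real))" for i
  proof (cases "Suc i = m")
    case False
    then have "x \<notin> cell n (Suc i)" using cell_unique[OF assms] by metis
    with False show ?thesis by simp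
  qed (use assms in simp)
  then have "c i * indicator (cell n (Suc i)) x = (if i = m - 1 then (if 1
      \<le> m then c i else 0) else 0)" for i
    by (cases m) simp_all
  then have "(\<Sum>i<n. c i * indicator (cell n (Suc i)) x)
      = (\<Sum>i<n. if i = m - 1 then (if 1 \<le> m then c i else 0) else 0)"
    by (simp only:)
  also have "\<dots> = (if m - 1 < n then (if 1 \<le> m then c (m - 1) else 0) else 0)"
    by simp
  finally show ?thesis by auto
qed

lemma cell_measurable: "(indicator (cell n m) :: real \<Rightarrow> real) \<in> borel_measurable unit_leb"
  unfolding cell_def by (intro measurable_restrict_space1 borel_measurable_indicator) simp

lemma step_function_measurable:
  "(\<lambda>x. \<Sum>i<n. c i * indicator (cell n (Suc i)) x :: real) \<in> borel_measurable unit_leb"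
  by (intro borel_measurable_sum borel_measurable_times borel_measurable_const cell_measurable)

lemma square_integrable_indicator_cell: "square_integrable (indicator (cell n m))"
proof (rule square_integrable_bounded_by)
  show "square_integrable (\<lambda>x. 1)" by (intro square_integrable_continuous continuous_intros)
qed (auto simp: cell_measurable indicator_def)

lemma square_integrable_step_function:
  "square_integrable (\<lambda>x. \<Sum>i<n. c i * indicator (cell n (Suc i)) x)"
  by (intro square_integrable_sum square_integrable_scale square_integrable_indicator_cell)

lemma integral_cell:
  assumes f: "square_integrable f" and i: "i < n"
  shows "(LINT x|unit_leb. f x * indicator (cell n (Suc i)) x) =
    (LINT s|lebesgue_on {node n (i+1) - mesh n / 2 .. node n (i+1) + mesh n / 2}. f s)"
    (is "_ = (LINT s|lebesgue_on ?I. f s)")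
proof -
  have I: "?I \<subseteq> {0..1}" using cell_subset[of "i+1" n] i by simp
  have f_meas: "f \<in> borel_measurable unit_leb" using f by (simp add: square_integrable_def)
  have "(LINT x|lebesgue. indicator {0..1} x *\<^sub>R (f x * indicator (cell n (Suc i)) x))
      = (LINT x|lebesgue. indicator ?I x *\<^sub>R f x)"
  proof (rule integral_cong_AE)
    have "(\<lambda>x. f x * indicator (cell n (Suc i)) x) \<in> borel_measurable unit_leb"
      by (intro borel_measurable_times f_meas cell_measurable)
    then show "(\<lambda>x. indicator {0..1} x *\<^sub>R (f x * indicator (cell n (Suc i)) x))
        \<in> borel_measurable lebesgue"
      by (subst (asm) borel_measurable_restrict_space_iff) auto
    have "f \<in> borel_measurable (lebesgue_on ?I)"
      using f_meas I by (rule measurable_restrict_mono)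
    then show "(\<lambda>x. indicator ?I x *\<^sub>R f x) \<in> borel_measurable lebesgue"
      by (subst (asm) borel_measurable_restrict_space_iff) auto
    \<comment> \<open>The two integrals differ only in the right end point of the cell.\<close>
    have "AE x in lebesgue. x \<notin> {node n (i+1) + mesh n / 2}"
      by (intro AE_not_in) (auto simp: negligible_iff_null_sets[symmetric])
    then show "AE x in lebesgue. indicator {0..1} x *\<^sub>R (f x * indicator (cell n (Suc i)) x) =
        indicator ?I x *\<^sub>R f x"
    proof eventually_elim
      case (elim x)
      have "x \<in> cell n (Suc i) \<longleftrightarrow> x \<in> ?I" using elim by (auto simp: cell_def)
      with I show ?case by (auto simp: indicator_def)
    qed
  qed
  then show ?thesis by (simp add: integral_restrict_space)
qed

lemma grid_proj_eq:
  assumes "square_integrable f" "i < n"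
  shows "grid_proj n (abs_L2 f) $ i = 1 / mesh n * (LINT x|unit_leb. f x * indicator (cell n (Suc i)) x)"
  using assms by (simp add: grid_proj.abs_eq L2_eq_def integral_cell)

lemma grid_proj_carrier: "grid_proj n z \<in> carrier_vec n"
  by transfer simp

text \<open>
  Taking cell averages is the adjoint of forming step functions. This and the next lemma imply all
  algebraic and metric properties of the projections.
\<close>

lemma grid_proj_adjoint: "grid_inner n (grid_proj n z) v = z \<bullet> grid_embed n v"
proof -
  obtain f where f: "square_integrable f" "z = abs_L2 f" by (rule L2_abs_cases)
  have "f x * (\<Sum>i<n. v $ i * indicator (cell n (Suc i)) x) =
      (\<Sum>i<n. v $ i * (f x * indicator (cell n (Suc i)) x))" for x
    by (subst sum_distrib_left, rule sum.cong) (simp_all add: mult_ac)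
  then have "z \<bullet> grid_embed n v = (LINT x|unit_leb. (\<Sum>i<n. v $ i * (f x * indicator (cell n (Suc
      i)) x)))"
    unfolding f(2) grid_embed_eq inner_abs_L2[OF f(1) square_integrable_step_function] by simp
  also have "\<dots> = (\<Sum>i<n. v $ i * (LINT x|unit_leb. f x * indicator (cell n (Suc i)) x))"
    by (subst Bochner_Integration.integral_sum)
       (auto intro!: square_integrable_mult f square_integrable_indicator_cell)
  also have "\<dots> = (\<Sum>i<n. mesh n * (grid_proj n z $ i * v $ i))"
    using mesh_pos[of n] by (intro sum.cong) (auto simp: f grid_proj_eq)
  finally show ?thesis by (simp add: grid_inner_def sum_distrib_left)
qed

lemma grid_embed_isometric: "grid_embed n v \<bullet> grid_embed n w = grid_inner n v w"
proof -
  have m: "(LINT x|unit_leb. indicator (cell n (Suc i)) x) = mesh n" if "i < n" for i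
  proof -
    have "(LINT x|unit_leb. 1 * indicator (cell n (Suc i)) x) = mesh n"
      using mesh_pos[of n] that
      by (subst integral_cell) (auto simp: square_integrable_continuous measure_restrict_space)
    then show ?thesis by simp
  qed
  have disj: "(\<Sum>i<n. v $ i * indicator (cell n (Suc i)) x) * (\<Sum>i<n. w $ i * indicator (cell n (Suc i)) x)
      = (\<Sum>i<n. (v $ i * w $ i) * indicator (cell n (Suc i)) x)" if x: "x \<in> space unit_leb" for x
  proof -
    obtain k where "x \<in> cell n k" using in_cell[of x n] x by auto
    from this show ?thesis
      by (simp only: step_function_value[OF \<open>x \<in> cell n k\<close>]) simp
  qed
  have "grid_embed n v \<bullet> grid_embed n w =
      (LINT x|unit_leb. (\<Sum>i<n. (v $ i * w $ i) * indicator (cell n (Suc i)) x))"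
    unfolding grid_embed_eq inner_abs_L2[OF square_integrable_step_function
        square_integrable_step_function]
    by (rule Bochner_Integration.integral_cong[OF refl disj])
  also have "\<dots> = (\<Sum>i<n. (v $ i * w $ i) * (LINT x|unit_leb. indicator (cell n (Suc i)) x))"
    using square_integrable_mult[OF square_integrable_indicator_cell square_integrable_continuous[OF
        continuous_on_const[of _ 1]]]
    by (subst Bochner_Integration.integral_sum) (auto intro!: integrable_mult_right)
  also have "\<dots> = (\<Sum>i<n. (v $ i * w $ i) * mesh n)"
    by (rule sum.cong) (simp_all only: m lessThan_iff)
  also have "\<dots> = grid_inner n v w"
    by (simp add: grid_inner_def sum_distrib_left mult_ac)
  finally show ?thesis .
qed

lemma grid_embed_add:
  assumes "v \<in> carrier_vec n" "w \<in> carrier_vec n"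
  shows "grid_embed n (v + w) = grid_embed n v + grid_embed n w"
proof -
  have "(\<Sum>i<n. (v + w) $ i * indicator (cell n (Suc i)) x) =
      (\<Sum>i<n. v $ i * indicator (cell n (Suc i)) x) + (\<Sum>i<n. w $ i * indicator (cell n (Suc i)) x)" for x
    by (subst sum.distrib[symmetric], rule sum.cong) (use assms in \<open>simp_all add: distrib_right\<close>)
  then show ?thesis by (simp only: grid_embed_eq abs_L2_add square_integrable_step_function)
qed

lemma grid_embed_smult:
  assumes "v \<in> carrier_vec n"
  shows "grid_embed n (c \<cdot>\<^sub>v v) = c *\<^sub>R grid_embed n v"
proof -
  have "(\<Sum>i<n. (c \<cdot>\<^sub>v v) $ i * indicator (cell n (Suc i)) x) =
      c * (\<Sum>i<n. v $ i * indicator (cell n (Suc i)) x)" for x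
    by (subst sum_distrib_left, rule sum.cong) (use assms in \<open>simp_all add: mult_ac\<close>)
  then show ?thesis by (simp only: grid_embed_eq abs_L2_scale square_integrable_step_function)
qed

lemma grid_embed_diff:
  assumes "v \<in> carrier_vec n" "w \<in> carrier_vec n"
  shows "grid_embed n (v - w) = grid_embed n v - grid_embed n w"
proof -
  have "grid_embed n (v - w) + grid_embed n w = grid_embed n ((v - w) + w)"
    using assms by (subst grid_embed_add) auto
  also have "(v - w) + w = v" using assms by (intro eq_vecI) auto
  finally show ?thesis by (simp add: eq_diff_eq)
qed

text \<open>
  The projections are determined by the adjoint relation, so identities between them can be tested
  against the embedding.
\<close>

lemma grid_proj_eqI:
  assumes "v \<in> carrier_vec n"
    and "\<And>w. w \<in> carrier_vec n \<Longrightarrow> z \<bullet> grid_embed n w = grid_inner n v w"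
  shows "grid_proj n z = v"
proof (rule eq_vecI)
  fix i assume "i < dim_vec v"
  then have i: "i < n" using assms(1) by simp
  have *: "grid_inner n u (unit_vec n i) = mesh n * u $ i" for u
    using i by (simp add: grid_inner_def if_distrib cong: if_cong)
  have "grid_inner n (grid_proj n z) (unit_vec n i) = grid_inner n v (unit_vec n i)"
    using assms(2)[of "unit_vec n i"] by (simp add: grid_proj_adjoint)
  then show "grid_proj n z $ i = v $ i" using mesh_pos[of n] by (simp add: *)
qed (use assms(1) grid_proj_carrier[of n z] in auto)

lemma grid_inner_add:
  "v \<in> carrier_vec n \<Longrightarrow> w \<in> carrier_vec n \<Longrightarrow> grid_inner n (v + w) u = grid_inner n v u + grid_inner n w u"
  by (simp add: grid_inner_def distrib_right sum.distrib distrib_left)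

lemma grid_inner_diff:
  "v \<in> carrier_vec n \<Longrightarrow> w \<in> carrier_vec n \<Longrightarrow> grid_inner n (v - w) u = grid_inner n v u - grid_inner n w u"
  by (simp add: grid_inner_def left_diff_distrib sum_subtractf right_diff_distrib)

lemma grid_inner_smult:
  "v \<in> carrier_vec n \<Longrightarrow> grid_inner n (c \<cdot>\<^sub>v v) u = c * grid_inner n v u"
  by (simp add: grid_inner_def sum_distrib_left mult_ac)

lemma grid_proj_embed: "v \<in> carrier_vec n \<Longrightarrow> grid_proj n (grid_embed n v) = v"
  by (rule grid_proj_eqI) (simp_all add: grid_embed_isometric)

lemma grid_proj_add: "grid_proj n (z + w) = grid_proj n z + grid_proj n w"
  by (rule grid_proj_eqI)
     (auto simp: grid_proj_carrier grid_inner_add grid_proj_adjoint inner_add_left)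

lemma grid_proj_scaleR: "grid_proj n (c *\<^sub>R z) = c \<cdot>\<^sub>v grid_proj n z"
  by (rule grid_proj_eqI)
     (auto simp: grid_proj_carrier grid_inner_smult grid_proj_adjoint)

lemma grid_proj_0: "grid_proj n 0 = 0\<^sub>v n"
  by (rule grid_proj_eqI) (auto simp: grid_inner_def)

lemma grid_proj_diff: "grid_proj n (z - w) = grid_proj n z - grid_proj n w"
  by (rule grid_proj_eqI)
     (auto simp: grid_proj_carrier grid_inner_diff grid_proj_adjoint inner_diff_left)

definition grid_norm :: "nat \<Rightarrow> real Matrix.vec \<Rightarrow> real" where
  "grid_norm n v = sqrt (grid_inner n v v)"

lemma norm_grid_embed: "norm (grid_embed n v) = grid_norm n v"
  by (simp add: norm_eq_sqrt_inner grid_embed_isometric grid_norm_def)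

text \<open>
  \<open>\<parallel>P z\<parallel>\<^sup>2 = \<langle>z, E P z\<rangle> \<le> \<parallel>z\<parallel> \<parallel>E P z\<parallel> = \<parallel>z\<parallel> \<parallel>P z\<parallel>\<close>.
\<close>

lemma grid_norm_proj_le: "grid_norm n (grid_proj n z) \<le> norm z"
proof -
  let ?p = "grid_proj n z"
  have "(grid_norm n ?p)\<^sup>2 = z \<bullet> grid_embed n ?p"
    by (metis norm_grid_embed power2_norm_eq_inner grid_embed_isometric grid_proj_adjoint)
  also have "\<dots> \<le> norm z * grid_norm n ?p"
    using norm_cauchy_schwarz[of z "grid_embed n ?p"] by (simp add: norm_grid_embed)
  finally have "grid_norm n ?p * grid_norm n ?p \<le> norm z * grid_norm n ?p"
      by (simp add: power2_eq_square)
  moreover have "0 \<le> grid_norm n ?p" by (simp flip: norm_grid_embed)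
  ultimately show ?thesis
    by (cases "grid_norm n ?p = 0") auto
qed

section \<open>The grid spaces as Banach spaces\<close>

lemma grid_space_simps [simp]:
  "carrier (grid_space n) = carrier_vec n" "\<zero>\<^bsub>grid_space n\<^esub> = 0\<^sub>v n"
  "add (grid_space n) = (+)" "smult (grid_space n) = (\<cdot>\<^sub>v)" "nrm (grid_space n) = grid_norm n"
  by (simp_all add: grid_space_def grid_norm_def fun_eq_iff)

lemma type_space_simps [simp]:
  "carrier type_space = UNIV" "\<zero>\<^bsub>type_space\<^esub> = 0"
  "add type_space = (+)" "smult type_space = (*\<^sub>R)" "nrm type_space = norm"
  by (simp_all add: type_space_def)

lemma abelian_group_grid_space: "abelian_group (grid_space n)"
  by (rule abelian_groupI)
     (auto simp: assoc_add_vec comm_add_vec[of _ n] intro!: bexI[of _ "- _"])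

lemma vectorspace_grid_space: "vectorspace class_ring (grid_space n)"
  unfolding vectorspace_def
proof
  have "module class_ring (grid_space n)"
    unfolding module_def module_axioms_def
    using class_field[where 'a=real] abelian_group_grid_space
    by (auto simp: class_field_def field_def domain_def class_ring_simps add_smult_distrib_vec
        smult_add_distrib_vec smult_smult_assoc)
  then show "Module.module class_ring (grid_space n)" .
  show "field (class_ring :: real ring)" using class_field by (simp add: class_field_def)
qed

lemma vectorspace_type_space: "vectorspace class_ring (type_space :: 'a::real_normed_vector
    normed_module)"
  unfolding vectorspace_def
proof
  have "abelian_group (type_space :: 'a normed_module)"
    by (rule abelian_groupI) (auto simp: add_ac intro: exI[of _ "- _"])
  then show "Module.module class_ring (type_space :: 'a normed_module)"
    unfolding module_def module_axioms_def
    using class_field[where 'a=real]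
    by (auto simp: class_field_def field_def domain_def class_ring_simps scaleR_add_left
        scaleR_add_right)
  show "field (class_ring :: real ring)" using class_field by (simp add: class_field_def)
qed

lemma grid_space_minus:
  assumes "v \<in> carrier_vec n" "w \<in> carrier_vec n"
  shows "v \<ominus>\<^bsub>grid_space n\<^esub> w = v - w"
proof -
  interpret abelian_group "grid_space n" by (rule abelian_group_grid_space)
  have "\<ominus>\<^bsub>grid_space n\<^esub> w = - w"
    by (rule minus_equality) (use assms in auto)
  then show ?thesis using assms by (auto simp: a_minus_def)
qed

lemma linear_map_grid_proj: "linear_map class_ring type_space (grid_space n) (grid_proj n)"
  unfolding linear_map_def mod_hom_def mod_hom_axioms_def module_hom_def
  using vectorspace_grid_space[of n] vectorspace_type_space[where 'a=L2]
  by (auto simp: vectorspace_def grid_proj_carrier grid_proj_add grid_proj_scaleR)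

lemma linear_map_grid_embed: "linear_map class_ring (grid_space n) type_space (grid_embed n)"
  unfolding linear_map_def mod_hom_def mod_hom_axioms_def module_hom_def
  using vectorspace_grid_space[of n] vectorspace_type_space[where 'a=L2]
  by (auto simp: vectorspace_def grid_embed_add grid_embed_smult)

text \<open>
  The embedding is isometric and has a bounded left inverse, so completeness is inherited from \<open>L\<^sup>2\<close>.
\<close>

lemma grid_space_complete:
  assumes X: "\<And>k::nat. X k \<in> carrier_vec n"
    and cauchy: "\<And>e. 0 < e \<Longrightarrow> \<exists>N. \<forall>k\<ge>N. \<forall>l\<ge>N. grid_norm n (X k - X l) < e"
  shows "\<exists>v\<in>carrier_vec n. (\<lambda>k. grid_norm n (X k - v)) \<longlonglongrightarrow> 0"
proof -
  have "Cauchy (\<lambda>k. grid_embed n (X k))"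
    unfolding Cauchy_iff using cauchy by (simp add: X flip: norm_grid_embed grid_embed_diff)
  then obtain z where z: "(\<lambda>k. grid_embed n (X k)) \<longlonglongrightarrow> z"
    using Cauchy_convergent convergent_def by blast
  have lim: "(\<lambda>k. norm (grid_embed n (X k) - z)) \<longlonglongrightarrow> 0"
    using z by (simp add: LIM_zero tendsto_norm_zero)
  have bound: "norm (grid_norm n (X k - grid_proj n z)) \<le> norm (grid_embed n (X k) - z)" for k
    using grid_norm_proj_le[of n "grid_embed n (X k) - z"]
    by (simp add: grid_proj_diff grid_proj_embed X flip: norm_grid_embed)
  have "(\<lambda>k. grid_norm n (X k - grid_proj n z)) \<longlonglongrightarrow> 0"
    by (rule Lim_null_comparison[OF always_eventually lim], rule allI, rule bound)
  then show ?thesis using grid_proj_carrier by blast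
qed

lemma banach_space_grid_space: "banach_space (grid_space n)"
proof -
  have zero_iff: "grid_norm n v = 0 \<longleftrightarrow> v = 0\<^sub>v n" if v: "v \<in> carrier_vec n" for v
  proof
    assume "grid_norm n v = 0"
    then have "grid_embed n v = 0" by (simp flip: norm_grid_embed)
    then show "v = 0\<^sub>v n" using grid_proj_embed[OF v] by (simp add: grid_proj_0)
  qed (simp add: grid_norm_def grid_inner_def)
  have nonneg: "0 \<le> grid_norm n v" for v by (simp flip: norm_grid_embed)
  have homogeneous: "grid_norm n (a \<cdot>\<^sub>v v) = \<bar>a\<bar> * grid_norm n v" if "v \<in> carrier_vec n" for a v
    using that by (simp add: grid_embed_smult flip: norm_grid_embed)
  have triangle: "grid_norm n (v + w) \<le> grid_norm n v + grid_norm n w"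
    if "v \<in> carrier_vec n" "w \<in> carrier_vec n" for v w
    using that by (simp add: grid_embed_add norm_triangle_ineq flip: norm_grid_embed)
  have complete: "\<exists>v\<in>carrier_vec n. (\<lambda>k. grid_norm n (X k \<ominus>\<^bsub>grid_space n\<^esub> v)) \<longlonglongrightarrow> 0"
    if X: "range X \<subseteq> carrier_vec n"
      and cauchy: "\<forall>e>0. \<exists>N. \<forall>k\<ge>N. \<forall>l\<ge>N. grid_norm n (X k \<ominus>\<^bsub>grid_space n\<^esub> X l) < e" for X
  proof -
    have Xc: "X k \<in> carrier_vec n" for k using X by auto
    have "\<exists>v\<in>carrier_vec n. (\<lambda>k. grid_norm n (X k - v)) \<longlonglongrightarrow> 0"
      by (rule grid_space_complete) (use cauchy in \<open>simp_all add: Xc grid_space_minus\<close>)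
    then obtain v where v: "v \<in> carrier_vec n" "(\<lambda>k. grid_norm n (X k - v)) \<longlonglongrightarrow> 0" by blast
    then have "(\<lambda>k. grid_norm n (X k \<ominus>\<^bsub>grid_space n\<^esub> v)) \<longlonglongrightarrow> 0"
      by (simp only: grid_space_minus[OF Xc v(1)])
    with v(1) show ?thesis by (rule bexI[rotated])
  qed
  show ?thesis
    unfolding banach_space_def grid_space_simps
    using vectorspace_grid_space[of n] zero_iff nonneg homogeneous triangle complete
    by (intro conjI ballI allI impI) auto
qed

lemma bounded_operator_grid_proj: "bounded_operator type_space (grid_space n) (grid_proj n)"
  using linear_map_grid_proj grid_norm_proj_le by (auto simp: bounded_operator_def intro!: exI[of _ 1])

lemma bounded_operator_grid_embed: "bounded_operator (grid_space n) type_space (grid_embed n)"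
  using linear_map_grid_embed by (auto simp: bounded_operator_def norm_grid_embed intro!: exI[of _ 1])

lemma op_norm_le_1:
  assumes "carrier V \<noteq> {}" "\<And>v. v \<in> carrier V \<Longrightarrow> nrm W (T v) \<le> nrm V v" "\<And>v. v \<in> carrier V \<Longrightarrow> 0 \<le> nrm V v"
  shows "op_norm V W T \<le> 1"
  unfolding op_norm_def
  using assms by (intro cSUP_least) (auto simp: divide_le_eq_1 order.strict_iff_order)

lemma op_norm_grid_proj: "op_norm type_space (grid_space n) (grid_proj n) \<le> 1"
  by (rule op_norm_le_1) (simp_all add: grid_norm_proj_le)

lemma op_norm_grid_embed: "op_norm (grid_space n) type_space (grid_embed n) \<le> 1"
  by (rule op_norm_le_1) (auto simp: norm_grid_embed simp flip: norm_grid_embed intro: zero_carrier_vec)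

section \<open>Sampled sines\<close>

definition grid_sine :: "nat \<Rightarrow> nat \<Rightarrow> real Matrix.vec" where
  "grid_sine k n = Matrix.vec n (\<lambda>i. sine k (node n (Suc i)))"

lemma sine_lipschitz: "\<bar>sine k x - sine k y\<bar> \<le> real k * pi * \<bar>x - y\<bar>"
proof -
  have "\<bar>sin a - sin b\<bar> \<le> \<bar>a - b\<bar>" for a b :: real
  proof -
    have "\<bar>sin a - sin b\<bar> = 2 * (\<bar>sin ((a - b) / 2)\<bar> * \<bar>cos ((a + b) / 2)\<bar>)"
      by (simp add: sin_diff_sin abs_mult)
    also have "\<dots> \<le> 2 * (\<bar>(a - b) / 2\<bar> * 1)"
      by (intro mult_left_mono mult_mono abs_sin_x_le_abs_x) auto
    finally show ?thesis by simp
  qed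
  then have "\<bar>sine k x - sine k y\<bar> \<le> \<bar>real k * pi * x - real k * pi * y\<bar>"
    unfolding sine_def .
  also have "\<dots> = real k * pi * \<bar>x - y\<bar>" by (simp add: abs_mult flip: right_diff_distrib)
  finally show ?thesis .
qed

text \<open>
  The step function takes at \<open>x\<close> the value of the sine at the node nearest to \<open>x\<close>. This includes the
  outermost half cells, where the step function is \<open>0\<close>, because the sine vanishes at the nodes
  \<open>0\<close> and \<open>1\<close>.
\<close>

lemma grid_embed_grid_sine_tendsto: "(\<lambda>n. grid_embed n (grid_sine k n)) \<longlonglongrightarrow> abs_L2 (sine k)"
  unfolding grid_embed_eq
proof (rule L2_dominated_convergence)
  show "square_integrable (\<lambda>x. 1)" by (intro square_integrable_continuous continuous_intros)
  show "sine k \<in> borel_measurable unit_leb"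
    unfolding sine_def[abs_def] by (intro measurable_continuous_unit_leb continuous_intros)
  have on_grid: "\<exists>m. x \<in> cell n m \<and> (\<Sum>i<n. grid_sine k n $ i * indicator (cell n (Suc i)) x)
      = sine k (node n m)"
    if x: "0 \<le> x" "x \<le> 1" for x n
  proof -
    obtain m where m: "m \<le> Suc n" "x \<in> cell n m" using in_cell[OF x] .
    have "(\<Sum>i<n. grid_sine k n $ i * indicator (cell n (Suc i)) x)
        = (if 1 \<le> m \<and> m \<le> n then grid_sine k n $ (m - 1) else 0)"
      by (rule step_function_value[OF m(2)])
    also have "\<dots> = sine k (node n m)"
      using m(1) by (auto simp: grid_sine_def le_Suc_eq node_ends not_le sine_ends)
    finally show ?thesis using m(2) by blast
  qed
  show "AE x in unit_leb. \<bar>\<Sum>i<n. grid_sine k n $ i * indicator (cell n (Suc i)) x\<bar> \<le> 1" for n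
    using AE_unit_leb_interior
  proof eventually_elim
    case (elim x)
    with on_grid[of x n] show ?case by (auto simp: sine_def)
  qed
  show "AE x in unit_leb. (\<lambda>n. \<Sum>i<n. grid_sine k n $ i * indicator (cell n (Suc i)) x) \<longlonglongrightarrow> sine k x"
    using AE_unit_leb_interior
  proof eventually_elim
    case (elim x)
    have le: "\<bar>(\<Sum>i<n. grid_sine k n $ i * indicator (cell n (Suc i)) x) - sine k x\<bar>
        \<le> real k * pi * mesh n" for n
    proof -
      obtain m where m: "x \<in> cell n m"
          "(\<Sum>i<n. grid_sine k n $ i * indicator (cell n (Suc i)) x) = sine k (node n m)"
        using on_grid[of x n] elim by auto
      have "\<bar>sine k (node n m) - sine k x\<bar> \<le> real k * pi * \<bar>node n m - x\<bar>" by (rule sine_lipschitz)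
      also have "\<dots> \<le> real k * pi * mesh n"
        using m(1) mesh_pos[of n] by (intro mult_left_mono) (auto simp: cell_def)
      finally show ?thesis by (simp only: m(2))
    qed
    have "mesh \<longlonglongrightarrow> 0"
      unfolding mesh_def[abs_def] by real_asymp
    then have lim: "(\<lambda>n. real k * pi * mesh n) \<longlonglongrightarrow> 0" by (rule tendsto_mult_right_zero)
    have "(\<lambda>n. (\<Sum>i<n. grid_sine k n $ i * indicator (cell n (Suc i)) x) - sine k x) \<longlonglongrightarrow> 0"
      by (rule Lim_null_comparison[OF always_eventually lim], rule allI, simp only: real_norm_def le)
    then show ?case by (simp add: LIM_zero_iff)
  qed
qed (rule step_function_measurable)

section \<open>The exponential of a matrix\<close>

lemma mult_mat_vec_index:
  assumes "A \<in> carrier_mat n n" "w \<in> carrier_vec n" "i < n"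
  shows "(A *\<^sub>v w) $ i = (\<Sum>j<n. A $$ (i, j) * w $ j)"
  using assms by (auto simp: scalar_prod_def atLeast0LessThan intro!: sum.cong)

lemma pow_mat_mult_vec_carrier:
  assumes "A \<in> carrier_mat n n" "w \<in> carrier_vec n"
  shows "A ^\<^sub>m k *\<^sub>v w \<in> carrier_vec n"
  by (rule mult_mat_vec_carrier[OF pow_carrier_mat[OF assms(1)] assms(2)])

lemma pow_mat_Suc_mult_vec:
  assumes A: "A \<in> carrier_mat n n" and w: "w \<in> carrier_vec n"
  shows "A ^\<^sub>m Suc k *\<^sub>v w = A *\<^sub>v (A ^\<^sub>m k *\<^sub>v w)"
proof -
  have right: "A ^\<^sub>m Suc k *\<^sub>v w = A ^\<^sub>m k *\<^sub>v (A *\<^sub>v w)" if "w \<in> carrier_vec n" for w k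
    using that by (simp add: assoc_mult_mat_vec[OF pow_carrier_mat[OF A] A])
  show ?thesis
    using w
  proof (induction k arbitrary: w)
    case 0
    then show ?case using A by simp
  next
    case (Suc k)
    then have Aw: "A *\<^sub>v w \<in> carrier_vec n" using A by simp
    have "A ^\<^sub>m Suc (Suc k) *\<^sub>v w = A *\<^sub>v (A ^\<^sub>m k *\<^sub>v (A *\<^sub>v w))"
      by (simp only: right[OF Suc.prems] Suc.IH[OF Aw])
    then show ?case by (simp only: right[OF Suc.prems])
  qed
qed

lemma pow_mat_smult:
  fixes A :: "real Matrix.mat"
  assumes "A \<in> carrier_mat n n"
  shows "(t \<cdot>\<^sub>m A) ^\<^sub>m k = t ^ k \<cdot>\<^sub>m A ^\<^sub>m k"
proof (induction k)
  case 0
  show ?case using assms by (intro eq_matI) auto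
next
  case (Suc k)
  have "(t \<cdot>\<^sub>m A) ^\<^sub>m Suc k = (t ^ k \<cdot>\<^sub>m A ^\<^sub>m k) * (t \<cdot>\<^sub>m A)" by (simp add: Suc)
  also have "\<dots> = t ^ Suc k \<cdot>\<^sub>m (A ^\<^sub>m k * A)"
    using assms by (intro eq_matI) (auto simp: mult_smult_distrib[of _ n n _ n]
        mult_smult_assoc_mat[of _ n n _ n])
  finally show ?case by simp
qed

lemma pow_mat_mult_vec_bound:
  assumes A: "A \<in> carrier_mat n n" and w: "w \<in> carrier_vec n" and i: "i < n"
  shows "\<bar>(A ^\<^sub>m k *\<^sub>v w) $ i\<bar> \<le> (\<Sum>i<n. \<Sum>j<n. \<bar>A $$ (i, j)\<bar>) ^ k * (\<Sum>j<n. \<bar>w $ j :: real\<bar>)"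
  using i
proof (induction k arbitrary: i)
  case 0
  have "\<bar>w $ i\<bar> \<le> (\<Sum>j<n. \<bar>w $ j\<bar>)" using 0 by (intro member_le_sum) auto
  then show ?case using A w by simp
next
  case (Suc k)
  let ?a = "\<Sum>i<n. \<Sum>j<n. \<bar>A $$ (i, j)\<bar>" and ?c = "\<Sum>j<n. \<bar>w $ j\<bar>"
  have "\<bar>(A ^\<^sub>m Suc k *\<^sub>v w) $ i\<bar> = \<bar>\<Sum>j<n. A $$ (i, j) * (A ^\<^sub>m k *\<^sub>v w) $ j\<bar>"
    by (simp only: pow_mat_Suc_mult_vec[OF A w]
        mult_mat_vec_index[OF A pow_mat_mult_vec_carrier[OF A w] Suc.prems])
  also have "\<dots> \<le> (\<Sum>j<n. \<bar>A $$ (i, j)\<bar> * (?a ^ k * ?c))"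
    by (rule order_trans[OF sum_abs]) (auto intro!: sum_mono mult_left_mono Suc.IH simp: abs_mult)
  also have "\<dots> = (\<Sum>j<n. \<bar>A $$ (i, j)\<bar>) * (?a ^ k * ?c)" by (simp add: sum_distrib_right)
  also have "(\<Sum>j<n. \<bar>A $$ (i, j)\<bar>) \<le> ?a"
    using Suc.prems by (intro member_le_sum[of i "{..<n}" "\<lambda>i. \<Sum>j<n. \<bar>A $$ (i, j)\<bar>"]) (auto intro:
        sum_nonneg)
  finally show ?case by (simp add: mult_right_mono sum_nonneg mult_ac)
qed

lemma summable_mat_exp_series:
  assumes A: "A \<in> carrier_mat n n" and w: "w \<in> carrier_vec n" and i: "i < n"
  shows "summable (\<lambda>k. (A ^\<^sub>m k *\<^sub>v w) $ i / fact k * (t::real) ^ k)"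
proof (rule summable_comparison_test')
  let ?a = "\<Sum>i<n. \<Sum>j<n. \<bar>A $$ (i, j)\<bar>" and ?c = "\<Sum>j<n. \<bar>w $ j\<bar>"
  show "summable (\<lambda>k. ?c * (inverse (fact k) * (?a * \<bar>t\<bar>) ^ k))"
    by (intro summable_mult summable_exp)
  show "norm ((A ^\<^sub>m k *\<^sub>v w) $ i / fact k * t ^ k) \<le> ?c * (inverse (fact k) * (?a * \<bar>t\<bar>) ^ k)"
      if "0 \<le> k" for k
  proof -
    have "norm ((A ^\<^sub>m k *\<^sub>v w) $ i / fact k * t ^ k) = \<bar>(A ^\<^sub>m k *\<^sub>v w) $ i\<bar> * (\<bar>t\<bar> ^ k / fact k)"
      by (simp add: abs_mult power_abs)
    also have "\<dots> \<le> (?a ^ k * ?c) * (\<bar>t\<bar> ^ k / fact k)"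
      by (intro mult_right_mono pow_mat_mult_vec_bound assms) auto
    finally show ?thesis by (simp add: power_mult_distrib divide_inverse mult_ac)
  qed
qed

text \<open>
  Applied to a vector, the exponential of \<open>t A\<close> becomes in each component a power series in \<open>t\<close> with
  infinite radius of convergence, which can be differentiated term by term.
\<close>

lemma mat_exp_mult_vec_series:
  assumes A: "A \<in> carrier_mat n n" and w: "w \<in> carrier_vec n" and i: "i < n"
  shows "(mat_exp (t \<cdot>\<^sub>m A) *\<^sub>v w) $ i = (\<Sum>k. (A ^\<^sub>m k *\<^sub>v w) $ i / fact k * t ^ k)"
proof -
  have entry: "(A ^\<^sub>m k) $$ (i, j) = (A ^\<^sub>m k *\<^sub>v unit_vec n j) $ i" if "j < n" for k j
    using i that
    by (subst mult_mat_vec_index[OF pow_carrier_mat[OF A] unit_vec_carrier i])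
       (simp add: if_distrib cong: if_cong)
  have sm: "summable (\<lambda>k. ((t \<cdot>\<^sub>m A) ^\<^sub>m k) $$ (i, j) / fact k)" if "j < n" for j
  proof -
    have "((t \<cdot>\<^sub>m A) ^\<^sub>m k) $$ (i, j) / fact k = (A ^\<^sub>m k *\<^sub>v unit_vec n j) $ i / fact k * t ^ k" for k
    proof -
      have "((t \<cdot>\<^sub>m A) ^\<^sub>m k) $$ (i, j) = t ^ k * (A ^\<^sub>m k) $$ (i, j)"
        unfolding pow_mat_smult[OF A] using carrier_matD[OF pow_carrier_mat[OF A, of k]] i that by simp
      then show ?thesis by (simp only: entry[OF that]) (simp only: times_divide_eq_left
          mult.commute[of "t ^ k"])
    qed
    then show ?thesis by (simp only: summable_mat_exp_series[OF A unit_vec_carrier i])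
  qed
  have "mat_exp (t \<cdot>\<^sub>m A) \<in> carrier_mat n n" using A by (auto simp: mat_exp_def)
  then have "(mat_exp (t \<cdot>\<^sub>m A) *\<^sub>v w) $ i = (\<Sum>j<n. (\<Sum>k. ((t \<cdot>\<^sub>m A) ^\<^sub>m k) $$ (i, j) / fact k) * w $ j)"
    using A i by (subst mult_mat_vec_index[OF _ w i]) (auto simp: mat_exp_def)
  also have "\<dots> = (\<Sum>j<n. (\<Sum>k. ((t \<cdot>\<^sub>m A) ^\<^sub>m k) $$ (i, j) / fact k * w $ j))"
    by (intro sum.cong suminf_mult2[OF sm]) auto
  also have "\<dots> = (\<Sum>k. \<Sum>j<n. ((t \<cdot>\<^sub>m A) ^\<^sub>m k) $$ (i, j) / fact k * w $ j)"
    by (intro suminf_sum[symmetric] summable_mult2 sm) auto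
  also have "\<dots> = (\<Sum>k. (A ^\<^sub>m k *\<^sub>v w) $ i / fact k * t ^ k)"
  proof (rule arg_cong[where f = suminf], rule ext)
    fix k
    show "(\<Sum>j<n. ((t \<cdot>\<^sub>m A) ^\<^sub>m k) $$ (i, j) / fact k * w $ j) = (A ^\<^sub>m k *\<^sub>v w) $ i / fact k * t ^ k"
      using A i by (subst mult_mat_vec_index[OF _ w i])
        (auto simp: pow_mat_smult[OF A] sum_distrib_right sum_divide_distrib intro!: sum.cong)
  qed
  finally show ?thesis .
qed

lemma mat_exp_mult_vec_has_derivative:
  assumes A: "A \<in> carrier_mat n n" and w: "w \<in> carrier_vec n" and i: "i < n"
  shows "((\<lambda>t. (mat_exp (t \<cdot>\<^sub>m A) *\<^sub>v w) $ i) has_real_derivative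
    (\<Sum>j<n. A $$ (i, j) * (mat_exp (t \<cdot>\<^sub>m A) *\<^sub>v w) $ j)) (at t)"
proof -
  let ?c = "\<lambda>i k. (A ^\<^sub>m k *\<^sub>v w) $ i / fact k"
  have "((\<lambda>t. \<Sum>k. ?c i k * t ^ k) has_real_derivative (\<Sum>k. diffs (?c i) k * t ^ k)) (at t)"
    by (rule termdiffs_strong_converges_everywhere) (rule summable_mat_exp_series[OF A w i])
  moreover have "(\<lambda>t. \<Sum>k. ?c i k * t ^ k) = (\<lambda>t. (mat_exp (t \<cdot>\<^sub>m A) *\<^sub>v w) $ i)"
    by (simp only: mat_exp_mult_vec_series[OF A w i])
  moreover have "(\<Sum>k. diffs (?c i) k * t ^ k) = (\<Sum>j<n. A $$ (i, j) * (mat_exp (t \<cdot>\<^sub>m A) *\<^sub>v w) $ j)"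
  proof -
    have "diffs (?c i) k = (\<Sum>j<n. A $$ (i, j) * ?c j k)" for k
    proof -
      have "diffs (?c i) k = (A *\<^sub>v (A ^\<^sub>m k *\<^sub>v w)) $ i / fact k"
        unfolding diffs_def pow_mat_Suc_mult_vec[OF A w] by (simp add: fact_Suc del: of_nat_Suc)
      then show ?thesis
        by (simp only: mult_mat_vec_index[OF A pow_mat_mult_vec_carrier[OF A w] i] sum_divide_distrib
            times_divide_eq_right)
    qed
    then have "(\<Sum>k. diffs (?c i) k * t ^ k) = (\<Sum>k. \<Sum>j<n. A $$ (i, j) * (?c j k * t ^ k))"
      by (simp only: sum_distrib_right mult.assoc)
    also have "\<dots> = (\<Sum>j<n. \<Sum>k. A $$ (i, j) * (?c j k * t ^ k))"
      by (intro suminf_sum summable_mult summable_mat_exp_series[OF A w]) auto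
    also have "\<dots> = (\<Sum>j<n. A $$ (i, j) * (\<Sum>k. ?c j k * t ^ k))"
      by (intro sum.cong suminf_mult summable_mat_exp_series[OF A w]) auto
    finally show ?thesis by (simp add: mat_exp_mult_vec_series[OF A w])
  qed
  ultimately show ?thesis by simp
qed

lemma mat_exp_mult_eigenvector:
  assumes A: "A \<in> carrier_mat n n" and w: "w \<in> carrier_vec n" and eig: "A *\<^sub>v w = l \<cdot>\<^sub>v w"
  shows "mat_exp (t \<cdot>\<^sub>m A) *\<^sub>v w = exp (l * t) \<cdot>\<^sub>v w"
proof (rule eq_vecI)
  fix i assume "i < dim_vec (exp (l * t) \<cdot>\<^sub>v w)"
  then have i: "i < n" using w by simp
  have pow: "A ^\<^sub>m k *\<^sub>v w = l ^ k \<cdot>\<^sub>v w" for k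
  proof (induction k)
    case 0
    show ?case using A w by simp
  next
    case (Suc k)
    show ?case
      using A w by (simp only: pow_mat_Suc_mult_vec[OF A w] Suc mult_mat_vec[OF A w] eig)
        (simp add: smult_smult_assoc mult.commute)
  qed
  have "(mat_exp (t \<cdot>\<^sub>m A) *\<^sub>v w) $ i = (\<Sum>k. (l * t) ^ k /\<^sub>R fact k * w $ i)"
    using w i unfolding mat_exp_mult_vec_series[OF A w i] pow
    by (simp add: power_mult_distrib divide_inverse mult_ac)
  also have "\<dots> = exp (l * t) * w $ i"
    unfolding exp_def by (rule suminf_mult2[symmetric]) (rule summable_exp_generic)
  finally show "(mat_exp (t \<cdot>\<^sub>m A) *\<^sub>v w) $ i = (exp (l * t) \<cdot>\<^sub>v w) $ i" using w i by simp
qed (use A w in \<open>simp add: mat_exp_def\<close>)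

text \<open>
  Estimate \<open>u\<^sub>i u\<^sub>j \<le> (u\<^sub>i\<^sup>2 + u\<^sub>j\<^sup>2) / 2\<close> off the diagonal, where the coefficients are nonnegative; on
  the diagonal it is an equality. By symmetry the bound is the sum of \<open>u\<^sub>i\<^sup>2\<close> times the row sums.
\<close>

lemma quadratic_form_nonpos:
  fixes a :: "nat \<Rightarrow> nat \<Rightarrow> real"
  assumes sym: "\<And>i j. i < n \<Longrightarrow> j < n \<Longrightarrow> a i j = a j i"
    and off: "\<And>i j. i < n \<Longrightarrow> j < n \<Longrightarrow> i \<noteq> j \<Longrightarrow> 0 \<le> a i j"
    and row: "\<And>i. i < n \<Longrightarrow> (\<Sum>j<n. a i j) \<le> 0"
  shows "(\<Sum>i<n. \<Sum>j<n. a i j * (u i * u j)) \<le> 0"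
proof -
  have "(\<Sum>i<n. \<Sum>j<n. a i j * (u i * u j)) \<le> (\<Sum>i<n. \<Sum>j<n. a i j * ((u i)\<^sup>2 / 2) + a i j * ((u j)\<^sup>2 / 2))"
  proof (intro sum_mono)
    fix i j assume "i \<in> {..<n}" "j \<in> {..<n}"
    then show "a i j * (u i * u j) \<le> a i j * ((u i)\<^sup>2 / 2) + a i j * ((u j)\<^sup>2 / 2)"
    proof (cases "i = j")
      case True
      then show ?thesis by (simp add: power2_eq_square)
    next
      case False
      have "u i * u j \<le> (u i)\<^sup>2 / 2 + (u j)\<^sup>2 / 2" using sum_squares_bound[of "u i" "u j"] by simp
      then have "a i j * (u i * u j) \<le> a i j * ((u i)\<^sup>2 / 2 + (u j)\<^sup>2 / 2)"
        using off[of i j] False \<open>i \<in> _\<close> \<open>j \<in> _\<close> by (intro mult_left_mono) auto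
      then show ?thesis by (simp only: distrib_left)
    qed
  qed
  also have "\<dots> = (\<Sum>i<n. \<Sum>j<n. a i j * ((u i)\<^sup>2 / 2)) + (\<Sum>i<n. \<Sum>j<n. a i j * ((u j)\<^sup>2 / 2))"
    by (simp add: sum.distrib)
  also have "(\<Sum>i<n. \<Sum>j<n. a i j * ((u j)\<^sup>2 / 2)) = (\<Sum>j<n. \<Sum>i<n. a j i * ((u j)\<^sup>2 / 2))"
    by (subst sum.swap) (auto intro!: sum.cong simp: sym)
  also have "(\<Sum>i<n. \<Sum>j<n. a i j * ((u i)\<^sup>2 / 2)) + (\<Sum>j<n. \<Sum>i<n. a j i * ((u j)\<^sup>2 / 2))
      = (\<Sum>i<n. (\<Sum>j<n. a i j) * (u i)\<^sup>2)"
    by (simp flip: sum.distrib sum_distrib_right)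
  also have "\<dots> \<le> 0"
    by (rule sum_nonpos, rule mult_nonpos_nonneg) (use row in simp_all)
  finally show ?thesis .
qed

text \<open>
  The derivative of the squared norm along a solution is twice the quadratic form of \<open>A\<close>.
\<close>

lemma mat_exp_contraction:
  assumes A: "A \<in> carrier_mat n n" and w: "w \<in> carrier_vec n" and t: "0 \<le> t"
    and nonpos: "\<And>u. (\<Sum>i<n. \<Sum>j<n. A $$ (i, j) * (u i * u j)) \<le> 0"
  shows "(\<Sum>i<n. ((mat_exp (t \<cdot>\<^sub>m A) *\<^sub>v w) $ i)\<^sup>2) \<le> (\<Sum>i<n. (w $ i)\<^sup>2)"
proof -
  define u where "u t i = (mat_exp (t \<cdot>\<^sub>m A) *\<^sub>v w) $ i" for t i
  have u0: "u 0 i = w $ i" if "i < n" for i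
    using A w that by (simp only: u_def mat_exp_mult_vec_series[OF A w that] powser_zero) simp
  have "((\<lambda>t. \<Sum>i<n. (u t i)\<^sup>2) has_real_derivative (2 * (\<Sum>i<n. \<Sum>j<n. A $$ (i, j) * (u s i * u s
      j)))) (at s)" for s
  proof -
    have "((\<lambda>t. (u t i)\<^sup>2) has_real_derivative 2 * (\<Sum>j<n. A $$ (i, j) * (u s i * u s j))) (at s)"
        if "i < n" for i
      using DERIV_power[OF mat_exp_mult_vec_has_derivative[OF A w that, of s], of 2]
      by (simp add: u_def sum_distrib_left mult_ac)
    then show ?thesis unfolding sum_distrib_left[of 2 _ "{..<n}"] by (intro DERIV_sum) auto
  qed
  then have "(\<Sum>i<n. (u t i)\<^sup>2) \<le> (\<Sum>i<n. (u 0 i)\<^sup>2)"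
    using nonpos
    by (intro DERIV_nonpos_imp_nonincreasing[OF t] exI[of _ "2 * (\<Sum>i<n. \<Sum>j<n. A $$ (i, j) * (u
        s i * u s j))" for s] conjI)
       (auto intro: mult_nonneg_nonpos)
  then show ?thesis by (simp add: u0) (simp add: u_def)
qed

section \<open>The finite-difference Laplacian\<close>

lemma grid_laplacian_carrier: "grid_laplacian \<alpha> n \<in> carrier_mat n n"
  by (simp add: grid_laplacian_def)

text \<open>
  The case distinctions express the Dirichlet condition: neighbours beyond the ends of the grid
  contribute \<open>0\<close>.
\<close>

lemma grid_laplacian_row:
  assumes "i < n"
  shows "(\<Sum>j<n. grid_laplacian \<alpha> n $$ (i, j) * w j) = \<alpha> / (mesh n)\<^sup>2 *
    ((if 0 < i then w (i - 1) else 0) + (if Suc i < n then w (Suc i) else 0) - 2 * w i)"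
proof -
  let ?c = "\<alpha> / (mesh n)\<^sup>2"
  have "grid_laplacian \<alpha> n $$ (i, j) * w j =
      (if j = i - 1 then (if 0 < i then ?c * w j else 0) else 0) +
      (if j = Suc i then ?c * w j else 0) - (if j = i then 2 * ?c * w j else 0)" if "j < n" for j
    using assms that by (cases i) (auto simp: grid_laplacian_def)
  then have "(\<Sum>j<n. grid_laplacian \<alpha> n $$ (i, j) * w j) =
      (\<Sum>j<n. (if j = i - 1 then (if 0 < i then ?c * w j else 0) else 0) +
      (if j = Suc i then ?c * w j else 0) - (if j = i then 2 * ?c * w j else 0))"
    by (intro sum.cong) auto
  also have "\<dots> = (if 0 < i then ?c * w (i - 1) else 0) + (if Suc i < n then ?c * w (Suc i) else
      0) - 2 * ?c * w i"
    using assms by (simp add: sum.distrib sum_subtractf less_imp_diff_less)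
  finally show ?thesis by (simp add: algebra_simps)
qed

lemma grid_laplacian_nonpos:
  assumes "0 \<le> \<alpha>"
  shows "(\<Sum>i<n. \<Sum>j<n. grid_laplacian \<alpha> n $$ (i, j) * (u i * u j)) \<le> 0"
proof (rule quadratic_form_nonpos)
  fix i assume i: "i < n"
  have "(\<Sum>j<n. grid_laplacian \<alpha> n $$ (i, j)) = \<alpha> / (mesh n)\<^sup>2 *
      ((if 0 < i then 1 else 0) + (if Suc i < n then 1 else 0) - 2)"
    using grid_laplacian_row[OF i, of \<alpha> "\<lambda>_. 1"] by simp
  also have "\<dots> \<le> 0"
    using assms by (intro mult_nonneg_nonpos) auto
  finally show "(\<Sum>j<n. grid_laplacian \<alpha> n $$ (i, j)) \<le> 0" .
qed (use assms in \<open>auto simp: grid_laplacian_def\<close>)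

text \<open>
  The eigenvalue of the difference matrix that belongs to the sampled sine of frequency \<open>k\<close>.
\<close>

definition grid_eigenvalue :: "real \<Rightarrow> nat \<Rightarrow> nat \<Rightarrow> real" where
  "grid_eigenvalue \<alpha> k n = - \<alpha> * (2 * (real n + 1) * sin (real k * pi / (2 * (real n + 1))))\<^sup>2"

lemma grid_sine_carrier: "grid_sine k n \<in> carrier_vec n"
  by (simp add: grid_sine_def)

lemma grid_sine_eigenvector:
  "grid_laplacian \<alpha> n *\<^sub>v grid_sine k n = grid_eigenvalue \<alpha> k n \<cdot>\<^sub>v grid_sine k n"
proof (rule eq_vecI)
  fix i assume "i < dim_vec (grid_eigenvalue \<alpha> k n \<cdot>\<^sub>v grid_sine k n)"
  then have i: "i < n" by (simp add: grid_sine_def)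
  define \<theta> where "\<theta> = real k * pi * mesh n"
  let ?w = "\<lambda>j. sin (real (Suc j) * \<theta>)"
  have entry: "grid_sine k n $ j = ?w j" if "j < n" for j
    using that by (simp add: grid_sine_def sine_def node_def \<theta>_def mult_ac)
  have left: "(if 0 < i then ?w (i - 1) else 0) = sin (real i * \<theta>)" by (cases i) simp_all
  have right: "(if Suc i < n then ?w (Suc i) else 0) = sin (real (Suc (Suc i)) * \<theta>)"
  proof (cases "Suc i < n")
    case False
    with i have "Suc i = n" by simp
    then have "real (Suc (Suc i)) * \<theta> = real k * pi" by (simp add: \<theta>_def mesh_def field_simps)
    with False show ?thesis by (simp only: if_False sin_npi)
  qed simp
  have three_point: "sin (a - b) + sin (a + b) - 2 * sin a = - ((2 * sin (b / 2))\<^sup>2 * sin a)"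
      for a b :: real
  proof -
    have "cos b = 1 - 2 * (sin (b / 2))\<^sup>2" using cos_double_sin[of "b / 2"] by simp
    then have "sin (a - b) + sin (a + b) - 2 * sin a = 2 * sin a * (1 - 2 * (sin (b / 2))\<^sup>2) - 2 * sin a"
      by (simp add: sin_add sin_diff)
    then show ?thesis by (simp add: power_mult_distrib algebra_simps)
  qed
  have "(grid_laplacian \<alpha> n *\<^sub>v grid_sine k n) $ i = (\<Sum>j<n. grid_laplacian \<alpha> n $$ (i, j) * ?w j)"
    unfolding mult_mat_vec_index[OF grid_laplacian_carrier grid_sine_carrier i]
    by (rule sum.cong) (simp_all only: entry lessThan_iff)
  also have "\<dots> = \<alpha> / (mesh n)\<^sup>2 * (sin (real i * \<theta>) + sin (real (Suc (Suc i)) * \<theta>) - 2 * ?w i)"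
    by (simp only: grid_laplacian_row[OF i] left right)
  also have "\<dots> = \<alpha> / (mesh n)\<^sup>2 * (- ((2 * sin (\<theta> / 2))\<^sup>2 * ?w i))"
  proof -
    have "real (Suc i) * \<theta> - \<theta> = real i * \<theta>" "real (Suc i) * \<theta> + \<theta> = real (Suc (Suc i)) * \<theta>"
      by (simp_all add: algebra_simps)
    from three_point[of "real (Suc i) * \<theta>" \<theta>, unfolded this] show ?thesis by (simp only:)
  qed
  also have "\<dots> = grid_eigenvalue \<alpha> k n * ?w i"
  proof -
    have angle: "real k * pi / (2 * (real n + 1)) = \<theta> / 2" by (simp add: \<theta>_def mesh_def)
    have "2 * (real n + 1) * sin (\<theta> / 2) = 2 * sin (\<theta> / 2) / mesh n" by (simp add: mesh_def)
    then have "grid_eigenvalue \<alpha> k n = - (\<alpha> / (mesh n)\<^sup>2 * (2 * sin (\<theta> / 2))\<^sup>2)"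
      unfolding grid_eigenvalue_def angle
          by (simp only: power_divide mult_minus_left times_divide_eq_left times_divide_eq_right)
    then show ?thesis by (simp only:) (simp only: mult_minus_left mult_minus_right mult.assoc)
  qed
  also have "\<dots> = (grid_eigenvalue \<alpha> k n \<cdot>\<^sub>v grid_sine k n) $ i"
  proof -
    have "i < dim_vec (grid_sine k n)" using i by (simp add: grid_sine_def)
    then show ?thesis by (simp only: index_smult_vec entry[OF i])
  qed
  finally show "(grid_laplacian \<alpha> n *\<^sub>v grid_sine k n) $ i = (grid_eigenvalue \<alpha> k n \<cdot>\<^sub>v grid_sine
      k n) $ i" .
qed (simp add: grid_sine_def grid_laplacian_def)

lemma grid_eigenvalue_tendsto: "(\<lambda>n. grid_eigenvalue \<alpha> k n) \<longlonglongrightarrow> - \<alpha> * (real k * pi)\<^sup>2"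
proof -
  have "(\<lambda>n. 2 * (real n + 1) * sin (c / (2 * (real n + 1)))) \<longlonglongrightarrow> c" for c :: real
    by real_asymp
  from tendsto_mult[OF tendsto_const tendsto_power[OF this]] show ?thesis
    unfolding grid_eigenvalue_def .
qed

lemma grid_eigenvalue_ge:
  assumes "0 \<le> \<alpha>"
  shows "- \<alpha> * (real k * pi)\<^sup>2 \<le> grid_eigenvalue \<alpha> k n"
proof -
  let ?N = "2 * (real n + 1)"
  have "\<bar>?N * sin (real k * pi / ?N)\<bar> = ?N * \<bar>sin (real k * pi / ?N)\<bar>" by (simp add: abs_mult)
  also have "\<dots> \<le> ?N * \<bar>real k * pi / ?N\<bar>" by (intro mult_left_mono abs_sin_x_le_abs_x) auto
  also have "\<dots> = \<bar>real k * pi\<bar>" by (simp add: abs_mult)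
  finally have "(?N * sin (real k * pi / ?N))\<^sup>2 \<le> (real k * pi)\<^sup>2" by (simp only: abs_le_square_iff)
  then show ?thesis unfolding grid_eigenvalue_def using assms
      by (simp only: mult_minus_left neg_le_iff_le mult_left_mono)
qed

lemma grid_semigroup_carrier: "grid_semigroup \<alpha> n t v \<in> carrier_vec n"
  by (rule carrier_vecI) (simp add: grid_semigroup_def mat_exp_def grid_laplacian_def)

lemma grid_semigroup_diff:
  assumes "v \<in> carrier_vec n" "w \<in> carrier_vec n"
  shows "grid_semigroup \<alpha> n t (v - w) = grid_semigroup \<alpha> n t v - grid_semigroup \<alpha> n t w"
proof -
  have "mat_exp (t \<cdot>\<^sub>m grid_laplacian \<alpha> n) \<in> carrier_mat n n"
      by (simp add: mat_exp_def grid_laplacian_def)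
  then show ?thesis unfolding grid_semigroup_def using assms by (rule mult_minus_distrib_mat_vec)
qed

lemma grid_semigroup_contraction:
  assumes "0 \<le> \<alpha>" "0 \<le> t" "v \<in> carrier_vec n"
  shows "grid_norm n (grid_semigroup \<alpha> n t v) \<le> grid_norm n v"
  using mat_exp_contraction[OF grid_laplacian_carrier assms(3,2) grid_laplacian_nonpos[OF assms(1)]]
      mesh_pos[of n]
  by (simp add: grid_norm_def grid_inner_def grid_semigroup_def mult_left_mono flip: power2_eq_square)

lemma grid_semigroup_grid_sine:
  "grid_semigroup \<alpha> n t (grid_sine k n) = exp (grid_eigenvalue \<alpha> k n * t) \<cdot>\<^sub>v grid_sine k n"
  unfolding grid_semigroup_def
  by (rule mat_exp_mult_eigenvector[OF grid_laplacian_carrier _ grid_sine_eigenvector]) (simp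
      add: grid_sine_def)

section \<open>Convergence of the discrete evolutions\<close>

text \<open>
  The usual \<open>\<epsilon>/2\<close> argument: approximate \<open>z\<close> in the dense span, where convergence is known, and
  estimate the error by the uniform bound.
\<close>

lemma equibounded_convergence_on_dense_span:
  fixes T :: "nat \<Rightarrow> 'a::real_normed_vector \<Rightarrow> 'b::real_normed_vector"
  assumes dense: "closure (span B) = UNIV"
    and T: "\<And>n. linear (T n)" "\<And>n z. norm (T n z) \<le> C * norm z"
    and L: "bounded_linear L"
    and B: "\<And>b. b \<in> B \<Longrightarrow> (\<lambda>n. T n b) \<longlonglongrightarrow> L b"
  shows "(\<lambda>n. T n z) \<longlonglongrightarrow> L z"
proof -
  interpret L: bounded_linear L by (rule L)
  obtain D where D: "\<And>z. norm (L z) \<le> norm z * D" using L.bounded by blast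
  have span: "(\<lambda>n. T n w) \<longlonglongrightarrow> L w" if "w \<in> span B" for w
    using that
  proof (induction rule: span_induct_alt)
    case base
    show ?case by (simp add: linear_0[OF T(1)] L.zero)
  next
    case (step c x y)
    then show ?case
      by (simp add: linear_add[OF T(1)] linear_scale[OF T(1)] L.add L.scaleR B tendsto_intros)
  qed
  show ?thesis
  proof (rule LIMSEQ_I)
    fix e :: real assume e: "0 < e"
    define K where "K = \<bar>C\<bar> + \<bar>D\<bar> + 1"
    have K: "0 < K" "\<bar>C\<bar> + \<bar>D\<bar> \<le> K" by (simp_all add: K_def add_nonneg_pos)
    have "z \<in> closure (span B)" using dense by simp
    then obtain w where w: "w \<in> span B" "norm (w - z) < e / (2 * K)"
      using e K(1) unfolding closure_approachable dist_norm
          by (metis divide_pos_pos mult_pos_pos zero_less_numeral)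
    obtain N where N: "\<And>n. N \<le> n \<Longrightarrow> norm (T n w - L w) < e / 2"
      using LIMSEQ_D[OF span[OF w(1)], of "e / 2"] e by auto
    have "norm (T n z - L z) < e" if "N \<le> n" for n
    proof -
      have "T n z - L z = (T n w - L w) + (L (w - z) - T n (w - z))"
        by (simp add: linear_diff[OF T(1)] L.diff)
      then have "norm (T n z - L z) \<le> norm (T n w - L w) + (norm (L (w - z)) + norm (T n (w - z)))"
        using norm_triangle_ineq[of "T n w - L w" "L (w - z) - T n (w - z)"]
          norm_triangle_ineq4[of "L (w - z)" "T n (w - z)"] by simp
      also have "norm (L (w - z)) + norm (T n (w - z)) \<le> (\<bar>C\<bar> + \<bar>D\<bar>) * norm (w - z)"
      proof -
        have "norm (L (w - z)) \<le> norm (w - z) * \<bar>D\<bar>"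
          by (rule order_trans[OF D mult_left_mono]) auto
        moreover have "norm (T n (w - z)) \<le> \<bar>C\<bar> * norm (w - z)"
          by (rule order_trans[OF T(2) mult_right_mono]) auto
        ultimately show ?thesis by (simp add: algebra_simps)
      qed
      also have "\<dots> \<le> K * norm (w - z)" using K by (intro mult_right_mono) auto
      also have "K * norm (w - z) \<le> K * (e / (2 * K))" using w(2) K by (intro mult_left_mono) auto
      also have "K * (e / (2 * K)) = e / 2" using K(1) by simp
      finally show ?thesis using N[OF that] by simp
    qed
    then show "\<exists>N. \<forall>n\<ge>N. norm (T n z - L z) < e" by blast
  qed
qed

lemma grid_proj_sine_tendsto: "(\<lambda>n. grid_norm n (grid_proj n (abs_L2 (sine k)) - grid_sine k n)) \<longlonglongrightarrow> 0"
proof (rule Lim_null_comparison[OF always_eventually])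
  show "\<forall>n. norm (grid_norm n (grid_proj n (abs_L2 (sine k)) - grid_sine k n))
      \<le> norm (abs_L2 (sine k) - grid_embed n (grid_sine k n))"
  proof
    fix n
    have "0 \<le> grid_norm n v" for v by (simp flip: norm_grid_embed)
    then show "norm (grid_norm n (grid_proj n (abs_L2 (sine k)) - grid_sine k n))
        \<le> norm (abs_L2 (sine k) - grid_embed n (grid_sine k n))"
      using grid_norm_proj_le[of n "abs_L2 (sine k) - grid_embed n (grid_sine k n)"]
      by (simp add: grid_proj_diff grid_proj_embed grid_sine_carrier)
  qed
  show "(\<lambda>n. norm (abs_L2 (sine k) - grid_embed n (grid_sine k n))) \<longlonglongrightarrow> 0"
    using tendsto_norm_zero[OF LIM_zero[OF grid_embed_grid_sine_tendsto[of k]]]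
    by (simp only: norm_minus_commute)
qed

lemma linear_grid_semigroup:
  "linear (\<lambda>z. grid_embed n (grid_semigroup \<alpha> n t (grid_proj n z)))"
proof (rule linearI)
  have M: "mat_exp (t \<cdot>\<^sub>m grid_laplacian \<alpha> n) \<in> carrier_mat n n"
      by (simp add: mat_exp_def grid_laplacian_def)
  note c = grid_semigroup_carrier[of \<alpha> n t, unfolded grid_semigroup_def]
  fix z w :: L2 and r :: real
  show "grid_embed n (grid_semigroup \<alpha> n t (grid_proj n (z + w))) =
      grid_embed n (grid_semigroup \<alpha> n t (grid_proj n z)) + grid_embed n (grid_semigroup \<alpha> n t
          (grid_proj n w))"
    unfolding grid_semigroup_def grid_proj_add
      mult_add_distrib_mat_vec[OF M grid_proj_carrier grid_proj_carrier]
    by (rule grid_embed_add[OF c c])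
  show "grid_embed n (grid_semigroup \<alpha> n t (grid_proj n (r *\<^sub>R z))) =
      r *\<^sub>R grid_embed n (grid_semigroup \<alpha> n t (grid_proj n z))"
    unfolding grid_semigroup_def grid_proj_scaleR mult_mat_vec[OF M grid_proj_carrier]
    by (rule grid_embed_smult[OF c])
qed

text \<open>
  Since the discrete evolutions are contractions, the limit depends only on the limit of the initial
  vectors and not on their choice.
\<close>

lemma discrete_evolution_close:
  assumes "0 \<le> \<alpha>" "0 \<le> t" and v: "\<And>n. v n \<in> carrier_vec n" and w: "\<And>n. w n \<in> carrier_vec n"
    and close: "(\<lambda>n. grid_norm n (v n - w n)) \<longlonglongrightarrow> 0"
    and lim: "(\<lambda>n. grid_embed n (grid_semigroup \<alpha> n t (w n))) \<longlonglongrightarrow> l"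
  shows "(\<lambda>n. grid_embed n (grid_semigroup \<alpha> n t (v n))) \<longlonglongrightarrow> l"
proof -
  have "(\<lambda>n. grid_embed n (grid_semigroup \<alpha> n t (v n - w n))) \<longlonglongrightarrow> 0"
    by (rule Lim_null_comparison[OF always_eventually close])
       (use v w assms(1,2) in \<open>simp add: norm_grid_embed grid_semigroup_contraction\<close>)
  from tendsto_add[OF this lim] show ?thesis
    by (simp add: grid_semigroup_diff v w grid_embed_diff grid_semigroup_carrier)
qed

text \<open>
  The limit enters only through its values on the sines, which makes the lemma applicable to the
  identity as well as to the semigroup.
\<close>

lemma grid_evolution_tendsto:
  assumes \<alpha>: "0 \<le> \<alpha>" and t: "0 \<le> t" and L: "bounded_linear L"
    and L_sine: "\<And>k. L (abs_L2 (sine k)) = exp (- \<alpha> * (real k * pi)\<^sup>2 * t) *\<^sub>R abs_L2 (sine k)"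
  shows "(\<lambda>n. grid_embed n (grid_semigroup \<alpha> n t (grid_proj n z))) \<longlonglongrightarrow> L z"
proof (rule equibounded_convergence_on_dense_span[OF sines_dense linear_grid_semigroup _ L])
  show "norm (grid_embed n (grid_semigroup \<alpha> n t (grid_proj n z))) \<le> 1 * norm z" for n z
    using order_trans[OF grid_semigroup_contraction[OF \<alpha> t grid_proj_carrier] grid_norm_proj_le]
    by (simp add: norm_grid_embed)
  fix b assume "b \<in> range (\<lambda>k. abs_L2 (sine k))"
  then obtain k where b: "b = abs_L2 (sine k)" by blast
  have "(\<lambda>n. exp (grid_eigenvalue \<alpha> k n * t) *\<^sub>R grid_embed n (grid_sine k n)) \<longlonglongrightarrow> L b"
    unfolding b L_sine by (intro tendsto_intros grid_eigenvalue_tendsto grid_embed_grid_sine_tendsto)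
  then have "(\<lambda>n. grid_embed n (grid_semigroup \<alpha> n t (grid_sine k n))) \<longlonglongrightarrow> L b"
    by (simp add: grid_semigroup_grid_sine grid_embed_smult grid_sine_carrier)
  then show "(\<lambda>n. grid_embed n (grid_semigroup \<alpha> n t (grid_proj n b))) \<longlonglongrightarrow> L b"
    using discrete_evolution_close[OF \<alpha> t grid_proj_carrier grid_sine_carrier grid_proj_sine_tendsto]
    by (simp only: b)
qed

lemma mat_exp_zero: "mat_exp (0 \<cdot>\<^sub>m A) *\<^sub>v w = w" if "A \<in> carrier_mat n n" "w \<in> carrier_vec n"
proof (rule eq_vecI)
  fix i assume "i < dim_vec w"
  then have i: "i < n" using that by simp
  show "(mat_exp (0 \<cdot>\<^sub>m A) *\<^sub>v w) $ i = w $ i"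
    using that i by (simp only: mat_exp_mult_vec_series[OF that i] powser_zero) simp
qed (use that in \<open>simp add: mat_exp_def\<close>)

text \<open>
  For \<open>\<alpha> = 0\<close> and \<open>t = 0\<close> the convergence of the evolutions is \<open>E\<^sub>n P\<^sub>n z \<rightarrow> z\<close>; and \<open>E\<^sub>n\<close> is isometric.
\<close>

lemma grid_norm_proj_tendsto: "(\<lambda>n. grid_norm n (grid_proj n z)) \<longlonglongrightarrow> norm z"
proof -
  have "(\<lambda>n. grid_embed n (grid_semigroup 0 n 0 (grid_proj n z))) \<longlonglongrightarrow> id z"
    by (rule grid_evolution_tendsto) (simp_all add: bounded_linear_ident id_def)
  then have "(\<lambda>n. norm (grid_embed n (grid_proj n z))) \<longlonglongrightarrow> norm z"
    by (intro tendsto_norm) (simp add: grid_semigroup_def mat_exp_zero[OF grid_laplacian_carrier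
        grid_proj_carrier])
  then show ?thesis by (simp add: norm_grid_embed)
qed

lemma approximation_sequence_grid: "approximation_sequence grid_space grid_proj grid_embed 1 1"
  unfolding approximation_sequence_def
  by (simp add: banach_space_grid_space bounded_operator_grid_proj bounded_operator_grid_embed
      grid_proj_embed grid_norm_proj_tendsto op_norm_grid_proj op_norm_grid_embed)

lemma semigroups_converge_grid:
  assumes \<alpha>: "0 < \<alpha>" and S: "C0_semigroup S" and gen: "generator S = heat_operator \<alpha>"
  shows "semigroups_converge grid_space grid_proj grid_embed (grid_semigroup \<alpha>) S"
  unfolding semigroups_converge_def vectors_converge_def
proof (intro allI impI)
  fix t :: real and zs :: "nat \<Rightarrow> real Matrix.vec" and z
  assume t: "0 \<le> t" and zs: "\<forall>n\<ge>1. zs n \<in> carrier (grid_space n)"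
    and conv: "(\<lambda>n. nrm (grid_space n) (grid_proj n z \<ominus>\<^bsub>grid_space n\<^esub> zs n)) \<longlonglongrightarrow> 0"
  \<comment> \<open>Only the members with \<open>1 \<le> n\<close> are known to be grid vectors.\<close>
  define v where "v n = (if 1 \<le> n then zs n else 0\<^sub>v n)" for n
  have v: "v n \<in> carrier_vec n" for n using zs by (simp add: v_def)
  have v_eq: "\<forall>\<^sub>F n in sequentially. v n = zs n"
    by (rule eventually_sequentiallyI[of 1]) (simp add: v_def)
  have sym: "grid_norm n (a - b) = grid_norm n (b - a)" if "a \<in> carrier_vec n" "b \<in> carrier_vec n"
      for n a b
    using that by (simp add: grid_embed_diff norm_minus_commute flip: norm_grid_embed)
  have "(\<lambda>n. grid_norm n (v n - grid_proj n z)) \<longlonglongrightarrow> 0"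
  proof (rule Lim_transform_eventually[OF conv])
    show "\<forall>\<^sub>F n in sequentially. nrm (grid_space n) (grid_proj n z \<ominus>\<^bsub>grid_space n\<^esub> zs n) =
        grid_norm n (v n - grid_proj n z)"
      using v_eq
    proof eventually_elim
      case (elim n)
      then show ?case
        using v[of n] sym[OF v[of n] grid_proj_carrier[of n z]]
            by (simp add: grid_space_minus grid_proj_carrier)
    qed
  qed
  moreover have "(\<lambda>n. grid_embed n (grid_semigroup \<alpha> n t (grid_proj n z))) \<longlonglongrightarrow> S t z"
  proof (rule grid_evolution_tendsto)
    show "bounded_linear (S t)" using S t by (simp add: C0_semigroup_def)
    show "S t (abs_L2 (sine k)) = exp (- \<alpha> * (real k * pi)\<^sup>2 * t) *\<^sub>R abs_L2 (sine k)" for k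
      by (rule C0_semigroup_eigenvector[OF S _ t]) (simp only: gen sine_eigenvector_heat_operator)
  qed (use \<alpha> t in auto)
  ultimately have "(\<lambda>n. grid_embed n (grid_semigroup \<alpha> n t (v n))) \<longlonglongrightarrow> S t z"
    using discrete_evolution_close[of \<alpha> t v "\<lambda>n. grid_proj n z"] \<alpha> t v grid_proj_carrier by simp
  then show "(\<lambda>n. grid_embed n (grid_semigroup \<alpha> n t (zs n))) \<longlonglongrightarrow> S t z"
    by (rule Lim_transform_eventually) (use v_eq in \<open>eventually_elim, simp\<close>)
qed

theorem lemma4p1:
  fixes \<alpha> :: real and S :: "real \<Rightarrow> L2 \<Rightarrow> L2" and M \<omega> :: "nat \<Rightarrow> real"
  assumes "0 < \<alpha>"
    and "C0_semigroup S"
    and "generator S = heat_operator \<alpha>"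
    and "\<And>n. 1 \<le> n \<Longrightarrow> M n = 1"
    and "\<And>n. 1 \<le> n \<Longrightarrow> \<omega> n = - \<alpha> * (2 * (real n + 1) * sin (pi / (2 * (real n + 1))))\<^sup>2"
  shows "approximation_sequence grid_space grid_proj grid_embed 1 1 \<and>
    semigroups_converge grid_space grid_proj grid_embed (grid_semigroup \<alpha>) S \<and>
    M \<longlonglongrightarrow> 1 \<and>
    \<omega> \<longlonglongrightarrow> - \<alpha> * pi\<^sup>2 \<and>
    (\<forall>n\<ge>1. - \<alpha> * pi\<^sup>2 \<le> \<omega> n)"
proof (intro conjI)
  have \<omega>: "\<omega> n = grid_eigenvalue \<alpha> 1 n" if "1 \<le> n" for n
    using assms(5)[OF that] by (simp add: grid_eigenvalue_def)
  show "M \<longlonglongrightarrow> 1"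
    by (rule tendsto_eventually, rule eventually_sequentiallyI[of 1], rule assms(4))
  have "(\<lambda>n. grid_eigenvalue \<alpha> 1 n) \<longlonglongrightarrow> - \<alpha> * pi\<^sup>2" using grid_eigenvalue_tendsto[of \<alpha> 1] by simp
  then show "\<omega> \<longlonglongrightarrow> - \<alpha> * pi\<^sup>2"
    by (rule Lim_transform_eventually) (rule eventually_sequentiallyI[of 1], simp add: \<omega>)
  show "\<forall>n\<ge>1. - \<alpha> * pi\<^sup>2 \<le> \<omega> n"
    using grid_eigenvalue_ge[of \<alpha> 1] assms(1) by (simp add: \<omega>)
qed (rule approximation_sequence_grid semigroups_converge_grid[OF assms(1-3)])+

end
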